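(* Let $(\mathbb{L},\mu)$ be a random iterated function system of contracting similarities on $\mathbb{R}^d$ satisfying the uniform open set condition, with $2\le\sup_\lambda\mathcal{N}_\lambda<\infty$ and $\mathbb{E}(\log\mathcal{N}_{\omega_1})>0$, and suppose that for every $\lambda\in\Lambda$ there is $c_\lambda\in[c_{\min},c_{\max}]$ with $c_\lambda^i=c_\lambda$ for every $1\le i\le\mathcal{N}_\lambda$, where $0<c_{\min}\le c_{\max}<1$. Assume $(\mathbb{L},\mu)$ is not almost deterministic. Let $F_\omega$ be the associated random homogeneous attractor and let $s$ be the common almost sure value of $\dim_H F_\omega$ and $\dim_P F_\omega$. Let $\varepsilon>0$. Then there exists a real number $\eta_0^*>0$ such that, with $\beta_0^*=\eta_0^*\operatorname{Var}(\log\mathfrak{S}_{\omega_1}^s)$, \[ \mathscr{P}^{h_1^*(t,\beta_0^*,\varepsilon)}(F_\omega)=\infty \] almost surely.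
   Context: **Random iterated function system (RIFS).** $\Lambda\subset\mathbb{R}^k$ is a non-empty compact set with a Borel probability measure $\mu$. For each $\lambda\in\Lambda$, $\mathbb{I}_\lambda=\{f_\lambda^1,\dots,f_\lambda^{\mathcal{N}_\lambda}\}$, $\mathcal{N}_\lambda\in\mathbb{N}$, $\mathcal{N}_\lambda\ge1$, is a finite family of maps of $\mathbb{R}^d$ with $|f_\lambda^i(x)-f_\lambda^i(y)|=c_\lambda^i|x-y|$, $c_\lambda^i\in(0,1)$. Put $\mathbb{L}=\{\mathbb{I}_\lambda\}_{\lambda\in\Lambda}$; the pair $(\mathbb{L},\mu)$ is the RIFS. The dependence on $\lambda$ is understood to be measurable, and there is a compact $\Delta\subset\mathbb{R}^d$ with $f_\lambda^i(\Delta)\subseteq\Delta$ for all $\lambda,i$. **UOSC.** There is a non-empty bounded open set $\mathcal{O}\subset\mathbb{R}^d$ with $f_\lambda^i(\mathcal{O})\subseteq\mathcal{O}$ and $f_\lambda^i(\mathcal{O})\cap f_\lambda^j(\mathcal{O})=\varnothing$ for all $\lambda\in\Lambda$, $1\le i\neq j\le\mathcal{N}_\lambda$. **Random homogeneous attractor.** $\Omega=\Lambda^{\mathbb{N}}$ with the product measure $\mathbb{P}_H=\mu^{\mathbb{N}}$; "almost surely", $\mathbb{E}$ and $\operatorname{Var}$ refer to $\mathbb{P}_H$. For $\omega=\omega_1\omega_2\cdots\in\Omega$, \[F_\omega=\bigcap_{k=1}^\infty\ \bigcup_{1\le j_i\le\mathcal{N}_{\omega_i},\,1\le i\le k} f_{\omega_1}^{j_1}\circ\cdots\circ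 f_{\omega_k}^{j_k}(\Delta).\] **Notation.** $\mathfrak{S}_\lambda^s=\sum_{j=1}^{\mathcal{N}_\lambda}(c_\lambda^j)^s$. Under these assumptions it is known that the Hausdorff and packing dimensions of $F_\omega$ are almost surely both equal to the unique $s$ with $\mathbb{E}(\log\mathfrak{S}_{\omega_1}^s)=0$. The RIFS is *almost deterministic* if there is $s$ with $\mathfrak{S}_\lambda^s=1$ for $\mu$-almost every $\lambda$. **Gauge function.** For $\beta>0$, $\gamma\in\mathbb{R}$ and small $t>0$, \[h_1^*(t,\beta,\gamma)=t^s\Big(\exp\big(-\sqrt{2\beta\log(1/t)\log\log(\beta\log(1/t))}\big)\Big)^{1-\gamma}.\] A function given by such a formula is used as a gauge function on an interval $(0,r_0]$ on which it is defined and non-decreasing, and is extended by the constant value at $r_0$ for $t>r_0$ (and $0$ at $0$). **Packing measure.** $\mathscr{P}^h_\delta(F)=\sup\{\sum_i h(|B_i|)\}$ over countable collections of disjoint balls $B_i$ centred in $F$ with radii $r_i\le\delta$ ($|B_i|=2r_i$ the diameter), $\mathscr{P}^h_0(F)=\lim_{\delta\to0}\mathscr{P}^h_\delta(F)$, and $\mathscr{P}^h(F)=\inf\{\sum_{i=1}^\infty\mathscr{P}^h_0(F_i): F\subseteq\bigcup_{i=1}^\infty F_i\}$. *)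

theory Defs
  imports "HOL-Probability.Probability"
begin

section \<open>Random iterated function systems of similarities\<close>

(* The maps of the IFS with parameter l are f l i for 1 <= i <= N l, with ratios c l i; values at
   other indices are irrelevant, so measurability in l is only required where f l i and c l i are
   part of the family. *)
locale rifs = prob_space \<mu>
  for \<Lambda> :: "'k::euclidean_space set" and \<mu> :: "'k measure" and N :: "'k \<Rightarrow> nat"
    and f :: "'k \<Rightarrow> nat \<Rightarrow> 'a::euclidean_space \<Rightarrow> 'a" and c :: "'k \<Rightarrow> nat \<Rightarrow> real"
    and \<Delta> :: "'a set" +
  assumes compact_param: "compact \<Lambda>" and param_nonempty: "\<Lambda> \<noteq> {}"
    and sets_mu: "sets \<mu> = sets (restrict_space borel \<Lambda>)"
    and N_ge_1: "\<And>l. l \<in> \<Lambda> \<Longrightarrow> 1 \<le> N l"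
    and ratio: "\<And>l i. l \<in> \<Lambda> \<Longrightarrow> i \<in> {1..N l} \<Longrightarrow> 0 < c l i \<and> c l i < 1"
    and similarity: "\<And>l i x y. l \<in> \<Lambda> \<Longrightarrow> i \<in> {1..N l} \<Longrightarrow>
           norm (f l i x - f l i y) = c l i * norm (x - y)"
    and N_measurable: "N \<in> measurable \<mu> (count_space UNIV)"
    and c_measurable: "\<And>i. 1 \<le> i \<Longrightarrow>
           (\<lambda>l. c l i) \<in> borel_measurable (restrict_space \<mu> {l \<in> \<Lambda>. i \<le> N l})"
    and f_measurable: "\<And>i x. 1 \<le> i \<Longrightarrow>
           (\<lambda>l. f l i x) \<in> borel_measurable (restrict_space \<mu> {l \<in> \<Lambda>. i \<le> N l})"
    and compact_Delta: "compact \<Delta>" and Delta_nonempty: "\<Delta> \<noteq> {}"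
    and Delta_invariant: "\<And>l i. l \<in> \<Lambda> \<Longrightarrow> i \<in> {1..N l} \<Longrightarrow> f l i ` \<Delta> \<subseteq> \<Delta>"

definition uniform_osc ::
    "'k set \<Rightarrow> ('k \<Rightarrow> nat) \<Rightarrow> ('k \<Rightarrow> nat \<Rightarrow> 'a::euclidean_space \<Rightarrow> 'a) \<Rightarrow> bool" where
  "uniform_osc \<Lambda> N f \<longleftrightarrow>
     (\<exists>U. U \<noteq> {} \<and> bounded U \<and> open U \<and>
        (\<forall>l\<in>\<Lambda>. (\<forall>i\<in>{1..N l}. f l i ` U \<subseteq> U) \<and>
               (\<forall>i\<in>{1..N l}. \<forall>j\<in>{1..N l}. i \<noteq> j \<longrightarrow> f l i ` U \<inter> f l j ` U = {})))"

(* Sequences are indexed from 0: w 0, w 1, ... stand for omega_1, omega_2, ... *)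
definition P_H :: "'k measure \<Rightarrow> (nat \<Rightarrow> 'k) measure" where
  "P_H \<mu> = Pi\<^sub>M UNIV (\<lambda>_. \<mu>)"

fun compose_maps ::
    "('k \<Rightarrow> nat \<Rightarrow> 'a \<Rightarrow> 'a) \<Rightarrow> (nat \<Rightarrow> 'k) \<Rightarrow> (nat \<Rightarrow> nat) \<Rightarrow> nat \<Rightarrow> 'a \<Rightarrow> 'a" where
  "compose_maps f w j 0 = id"
| "compose_maps f w j (Suc k) = compose_maps f w j k \<circ> f (w k) (j k)"

definition homogeneous_attractor ::
    "('k \<Rightarrow> nat) \<Rightarrow> ('k \<Rightarrow> nat \<Rightarrow> 'a \<Rightarrow> 'a) \<Rightarrow> 'a set \<Rightarrow> (nat \<Rightarrow> 'k) \<Rightarrow> 'a set" where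
  "homogeneous_attractor N f \<Delta> w =
     (\<Inter>k\<in>{1..}. \<Union>j\<in>{j. \<forall>i<k. j i \<in> {1..N (w i)}}. compose_maps f w j k ` \<Delta>)"

definition ratio_sum :: "('k \<Rightarrow> nat) \<Rightarrow> ('k \<Rightarrow> nat \<Rightarrow> real) \<Rightarrow> 'k \<Rightarrow> real \<Rightarrow> real" where
  "ratio_sum N c l t = (\<Sum>j = 1..N l. c l j powr t)"

definition almost_deterministic ::
    "'k measure \<Rightarrow> ('k \<Rightarrow> nat) \<Rightarrow> ('k \<Rightarrow> nat \<Rightarrow> real) \<Rightarrow> bool" where
  "almost_deterministic \<mu> N c \<longleftrightarrow> (\<exists>t. AE l in \<mu>. ratio_sum N c l t = 1)"

section \<open>Hausdorff and packing measures and dimensions\<close>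

(* The dimensions below use the exponents t > 0 only, so the convention 0 powr 0 = 0
   does not matter. *)
definition hausdorff_premeasure :: "real \<Rightarrow> real \<Rightarrow> 'a::euclidean_space set \<Rightarrow> ennreal" where
  "hausdorff_premeasure t \<delta> F =
     (INF U \<in> {U :: nat \<Rightarrow> 'a set. F \<subseteq> (\<Union>i. U i) \<and> (\<forall>i. bounded (U i) \<and> diameter (U i) \<le> \<delta>)}.
        \<Sum>i. ennreal (diameter (U i) powr t))"

definition hausdorff_measure :: "real \<Rightarrow> 'a::euclidean_space set \<Rightarrow> ennreal" where
  "hausdorff_measure t F = (SUP \<delta>\<in>{0<..}. hausdorff_premeasure t \<delta> F)"

definition hausdorff_dim :: "'a::euclidean_space set \<Rightarrow> real" where
  "hausdorff_dim F = Inf {t. 0 < t \<and> hausdorff_measure t F = 0}"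

(* A pair (x, r) stands for the closed ball with centre x and radius r > 0. *)
definition packings :: "real \<Rightarrow> 'a::euclidean_space set \<Rightarrow> ('a \<times> real) set set" where
  "packings \<delta> F =
     {B. countable B \<and> (\<forall>(x, r)\<in>B. x \<in> F \<and> 0 < r \<and> r \<le> \<delta>) \<and>
         disjoint_family_on (\<lambda>(x, r). cball x r) B}"

definition packing_premeasure_at ::
    "(real \<Rightarrow> real) \<Rightarrow> real \<Rightarrow> 'a::euclidean_space set \<Rightarrow> ennreal" where
  "packing_premeasure_at h \<delta> F =
     (SUP B\<in>packings \<delta> F. \<Sum>\<^sub>\<infinity>(x, r)\<in>B. ennreal (h (2 * r)))"

(* packing_premeasure_at is monotone in the scale, so the limit as the scale tends to 0
   is an infimum. *)
definition packing_premeasure :: "(real \<Rightarrow> real) \<Rightarrow> 'a::euclidean_space set \<Rightarrow> ennreal" where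
  "packing_premeasure h F = (INF \<delta>\<in>{0<..}. packing_premeasure_at h \<delta> F)"

definition packing_measure :: "(real \<Rightarrow> real) \<Rightarrow> 'a::euclidean_space set \<Rightarrow> ennreal" where
  "packing_measure h F =
     (INF G \<in> {G :: nat \<Rightarrow> 'a set. F \<subseteq> (\<Union>i. G i)}. \<Sum>i. packing_premeasure h (G i))"

definition packing_dim :: "'a::euclidean_space set \<Rightarrow> real" where
  "packing_dim F = Inf {t. 0 < t \<and> packing_measure (\<lambda>u. u powr t) F = 0}"

section \<open>Gauge functions\<close>

definition h1_star :: "real \<Rightarrow> real \<Rightarrow> real \<Rightarrow> real \<Rightarrow> real" where
  "h1_star s \<beta> \<gamma> t =
     t powr s * exp (- sqrt (2 * \<beta> * ln (1 / t) * ln (ln (\<beta> * ln (1 / t))))) powr (1 - \<gamma>)"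

(* Every logarithm is taken of a positive number and the root of a nonnegative one. *)
definition h1_defined :: "real \<Rightarrow> real \<Rightarrow> bool" where
  "h1_defined \<beta> t \<longleftrightarrow>
     0 < t \<and> 0 < \<beta> * ln (1 / t) \<and> 0 < ln (\<beta> * ln (1 / t)) \<and>
     0 \<le> 2 * \<beta> * ln (1 / t) * ln (ln (\<beta> * ln (1 / t)))"

definition h1_admissible :: "real \<Rightarrow> real \<Rightarrow> real \<Rightarrow> real \<Rightarrow> bool" where
  "h1_admissible s \<beta> \<gamma> r0 \<longleftrightarrow>
     0 < r0 \<and> (\<forall>t\<in>{0<..r0}. h1_defined \<beta> t) \<and> mono_on {0<..r0} (h1_star s \<beta> \<gamma>)"

definition gauge_extension :: "real \<Rightarrow> (real \<Rightarrow> real) \<Rightarrow> real \<Rightarrow> real" where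
  "gauge_extension r0 h t = (if t \<le> 0 then 0 else if t \<le> r0 then h t else h r0)"

end

theory Submission
  imports Defs "HOL-Real_Asymp.Real_Asymp"
begin

text \<open>
  In the equicontractive case the \<open>m\<close>-th level of the attractor consists of \<open>P m\<close> cylinders of common
  ratio \<open>C m\<close>, and \<open>P m * C m powr s\<close> is the exponential of a sum of \<open>m\<close> i.i.d. bounded variables.
  The open set condition makes the centres of the cylinders uniformly separated on the scale \<open>C m\<close>,
  so a fixed proportion of the cylinders meeting any relatively open part of the attractor carries
  disjoint balls of radius \<open>C m / 2\<close>. By Baire's theorem the packing measure is therefore infinite as
  soon as \<open>P m * h (C m)\<close> is unbounded.

  Comparing this with covers by cylinders for the gauges \<open>u powr t\<close> identifies \<open>s\<close>: the summands
  have mean zero, and their variance is positive because the system is not almost deterministic.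
  Since the factor \<open>\<eta>\<close> may be chosen small, the law of the iterated logarithm is not needed in its
  sharp form: it suffices that the sums exceed \<open>a * sqrt (m * ln (ln m))\<close> infinitely often for some
  \<open>a > 0\<close>, which follows from the central limit theorem and the second Borel--Cantelli lemma.
\<close>


section \<open>A lower bound of iterated logarithm type\<close>

text \<open>No relation between \<open>U\<close> and \<open>\<Delta>\<close> is assumed, and
  attractor points of different cylinders may coincide; only the images of one point
  \<open>x0\<close> of \<open>U\<close> are separated. Each image is therefore replaced by a nearby
  point, at distance at most a fixed multiple of \<open>C m\<close>, and a bounded-degree argument
  keeps a fixed proportion of these points. They must even lie in a set \<open>G\<close> that is
  merely dense in a piece of the attractor, because the sets of a countable cover are arbitrary. The
  value of \<open>s\<close> is obtained from one bound per dimension, from above for Hausdorff and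
  from below for packing. As both dimensions are assumed to equal \<open>s\<close> almost surely,
  these two bounds already force \<open>s = EN / EC\<close>, the zero of the mean of
  \<open>X t\<close>. The constant \<open>\<eta>\<close> balances two square roots. At
  \<open>t = C m\<close> the root in the gauge is at most
  \<open>a / 2 * sqrt (m * ln (ln m))\<close> once \<open>\<beta> * (- ln cmin)\<close> is small
  compared with \<open>a\<close>, while the sums reach twice that infinitely often; the surplus
  makes \<open>P m * h (C m)\<close> unbounded.\<close>

lemma (in prob_space) borel_cantelli_2:
  assumes indep: "indep_vars N Y (UNIV :: nat set)"
    and A: "\<And>k. A k \<in> sets (N k)"
    and nsum: "\<not> summable (\<lambda>k. prob (Y k -` A k \<inter> space M))"
  shows "AE x in M. \<exists>\<^sub>F k in sequentially. Y k x \<in> A k"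
proof -
  have rv[measurable]: "Y k \<in> measurable M (N k)" for k
    using indep by (auto simp: indep_vars_def)
  define P where "P k = prob (Y k -` A k \<inter> space M)" for k
  define C where "C k = space (N k) - A k" for k
  have C: "C k \<in> sets (N k)" for k using A by (auto simp: C_def)
  have PC: "prob (Y k -` C k \<inter> space M) = 1 - P k" for k
  proof -
    have "Y k -` C k \<inter> space M = space M - (Y k -` A k \<inter> space M)"
      using measurable_space[OF rv] by (auto simp: C_def)
    then show ?thesis
      unfolding P_def by (metis A measurable_sets prob_compl rv)
  qed
  have "AE x in M. \<exists>k\<ge>n. Y k x \<in> A k" for n
  proof -
    \<comment> \<open>\<open>Suc m\<close> keeps the index range nonempty, as
      \<open>indep_varsD\<close> requires. Independence and 1 - p <= exp (- p) then bound the
      probability that no index of the range is hit.\<close>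
    define I where "I m = (\<Inter>k\<in>{n..<n + Suc m}. Y k -` C k \<inter> space M)" for m
    have I_sets: "I m \<in> events" for m
      unfolding I_def using C by (intro sets.finite_INT) (auto intro!: measurable_sets[OF rv])
    have PI: "prob (I m) \<le> exp (- (\<Sum>k\<in>{n..<n + Suc m}. P k))" for m
    proof -
      have "prob (I m) = (\<Prod>k\<in>{n..<n + Suc m}. 1 - P k)"
        unfolding I_def PC[symmetric] by (rule indep_varsD[OF indep]) (auto simp: C)
      also have "\<dots> \<le> (\<Prod>k\<in>{n..<n + Suc m}. exp (- P k))"
        using exp_ge_add_one_self[of "- P _"] by (intro prod_mono) (auto simp: P_def)
      also have "\<dots> = exp (- (\<Sum>k\<in>{n..<n + Suc m}. P k))"
        by (simp only: sum_negf[symmetric] exp_sum finite_atLeastLessThan)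
      finally show ?thesis .
    qed
    have "prob (\<Inter>m. I m) \<le> e" if "e > 0" for e
    proof -
      have "\<not> summable (\<lambda>k. P (k + n))"
        using nsum summable_iff_shift[of P n] by (simp add: P_def[abs_def])
      then have "\<exists>m. - ln e < (\<Sum>k<m. P (k + n))"
      proof (rule contrapos_np)
        assume "\<nexists>m. - ln e < (\<Sum>k<m. P (k + n))"
        then show "summable (\<lambda>k. P (k + n))"
          by (intro bounded_imp_summable[where B = "- ln e"])
            (auto simp: P_def not_less lessThan_Suc_atMost[symmetric] simp del: sum.lessThan_Suc)
      qed
      then obtain m where m: "- ln e < (\<Sum>k<m. P (k + n))" by blast
      have "(\<Sum>k<m. P (k + n)) \<le> (\<Sum>k<Suc m. P (k + n))" by (simp add: P_def)
      also have "\<dots> = (\<Sum>k\<in>{n..<n + Suc m}. P k)"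
        using sum.shift_bounds_nat_ivl[of P 0 n "Suc m"] by (simp add: atLeast0LessThan add.commute)
      finally have "- (\<Sum>k\<in>{n..<n + Suc m}. P k) \<le> ln e" using m by linarith
      then have "exp (- (\<Sum>k\<in>{n..<n + Suc m}. P k)) \<le> e"
        by (metis exp_le_cancel_iff exp_ln that)
      moreover have "prob (\<Inter>m. I m) \<le> prob (I m)"
        using I_sets by (intro finite_measure_mono) auto
      ultimately show ?thesis using PI[of m] by linarith
    qed
    then have "prob (\<Inter>m. I m) \<le> 0" by (rule field_le_epsilon[of _ 0, simplified])
    then have "prob (\<Inter>m. I m) = 0" by (simp add: measure_le_0_iff)
    moreover have "(\<Inter>m. I m) \<in> events" using I_sets by auto
    ultimately have "(\<Inter>m. I m) \<in> null_sets M" by (auto simp: emeasure_eq_measure)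
    then have "AE x in M. x \<notin> (\<Inter>m. I m)" by (rule AE_not_in)
    with AE_space show ?thesis
    proof eventually_elim
      case (elim x)
      then obtain m k where "k \<in> {n..<n + Suc m}" "x \<notin> Y k -` C k \<inter> space M" unfolding I_def by blast
      with elim measurable_space[OF rv, of x k] show ?case by (auto simp: C_def)
    qed
  qed
  then have "AE x in M. \<forall>n. \<exists>k\<ge>n. Y k x \<in> A k" by (simp add: AE_all_countable)
  then show ?thesis by (simp add: frequently_sequentially)
qed

text \<open>The density is positive everywhere, so full mass on \<open>{..1}\<close> would make the
  complement Lebesgue null although it contains \<open>{1<..2}\<close>. The gap below 1 supplies the
  constant of \<open>clt_tail\<close>.\<close>

lemma std_normal_tail_pos: "measure std_normal_distribution {..1} < 1"
proof -
  interpret N: real_distribution std_normal_distribution by (rule real_dist_normal_dist)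
  have "measure std_normal_distribution {..1} \<noteq> 1"
  proof
    assume "measure std_normal_distribution {..1} = 1"
    then have "AE x in std_normal_distribution. x \<in> {..1}"
      by (intro N.AE_prob_1) auto
    then have "AE x in lborel. x \<in> {..(1::real)}"
      by (subst (asm) AE_density) (auto elim!: eventually_mono simp: normal_density_pos)
    then have "{..(1::real)} \<in> sets lborel \<and> emeasure lborel (- {..(1::real)}) = 0"
      by (subst (asm) AE_iff_measurable[OF _ refl]) (auto simp: Compl_eq)
    moreover have "emeasure lborel {1<..2::real} \<le> emeasure lborel (- {..(1::real)})"
      by (intro emeasure_mono) auto
    ultimately show False by simp
  qed
  then show ?thesis using N.prob_le_1[of "{..1}"] by linarith
qed

text \<open>Used twice: with centred summands \<open>g (w i) - E g\<close> for the law of large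
  numbers behind the dimension bounds, and with \<open>X s (w i)\<close>, whose mean is zero, for
  the fluctuation bound.\<close>

locale iid_centered = prob_space M for M :: "'a measure" +
  fixes X :: "nat \<Rightarrow> 'a \<Rightarrow> real"
  assumes indep: "indep_vars (\<lambda>_. borel) X UNIV"
    and ident: "distr M borel (X n) = distr M borel (X 0)"
    and sq_integrable_0: "integrable M (\<lambda>x. (X 0 x)\<^sup>2)"
    and mean_0: "expectation (X 0) = 0"
begin

definition v :: real where "v = expectation (\<lambda>x. (X 0 x)\<^sup>2)"

text \<open>Indexed by sets rather than by lengths, since the blocks below are intervals that do not
  start at 0.\<close>

definition S :: "nat set \<Rightarrow> 'a \<Rightarrow> real" where "S A x = (\<Sum>i\<in>A. X i x)"

section \<open>Moments, a law of large numbers along squares, and tails from the central limit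
  theorem\<close>

lemma rv[measurable]: "X n \<in> borel_measurable M"
  using indep by (auto simp: indep_vars_def)

lemma S_measurable[measurable]: "S A \<in> borel_measurable M"
  unfolding S_def[abs_def] by measurable

lemma sq_integrable: "integrable M (\<lambda>x. (X n x)\<^sup>2)"
  using sq_integrable_0 integrable_distr_eq[of "X n" M borel "\<lambda>x. x\<^sup>2"]
    integrable_distr_eq[of "X 0" M borel "\<lambda>x. x\<^sup>2"] ident[of n] by simp

lemma X_integrable: "integrable M (X n)"
  by (rule square_integrable_imp_integrable[OF _ sq_integrable]) simp

lemma expectation_ident:
  fixes g :: "real \<Rightarrow> real"
  assumes [measurable]: "g \<in> borel_measurable borel"
  shows "expectation (\<lambda>x. g (X n x)) = expectation (\<lambda>x. g (X 0 x))"
proof -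
  have "expectation (\<lambda>x. g (X n x)) = integral\<^sup>L (distr M borel (X n)) g"
    by (subst integral_distr) auto
  also have "\<dots> = integral\<^sup>L (distr M borel (X 0)) g"
    by (subst ident) (rule refl)
  also have "\<dots> = expectation (\<lambda>x. g (X 0 x))"
    by (subst integral_distr) auto
  finally show ?thesis .
qed

lemma mean: "expectation (X n) = 0"
  using expectation_ident[of "\<lambda>x. x" n] mean_0 by auto

lemma second_moment: "expectation (\<lambda>x. (X n x)\<^sup>2) = v"
  using expectation_ident[of "\<lambda>x. x\<^sup>2" n] by (simp add: v_def)

lemma S_moments:
  assumes "finite A"
  shows "integrable M (S A)" "expectation (S A) = 0"
    "integrable M (\<lambda>x. (S A x)\<^sup>2)" "expectation (\<lambda>x. (S A x)\<^sup>2) = card A * v"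
proof -
  show "integrable M (S A)"
    unfolding S_def[abs_def] by (intro Bochner_Integration.integrable_sum X_integrable)
  show "expectation (S A) = 0"
    unfolding S_def[abs_def] by (subst Bochner_Integration.integral_sum) (auto simp: X_integrable mean)
  have "integrable M (\<lambda>x. (S A x)\<^sup>2) \<and> expectation (\<lambda>x. (S A x)\<^sup>2) = card A * v"
    using assms
  proof induction
    case empty then show ?case by (simp add: S_def)
  next
    case (insert a F)
    have iF: "integrable M (S F)"
      unfolding S_def[abs_def] by (intro Bochner_Integration.integrable_sum X_integrable)
    have mF: "expectation (S F) = 0"
      unfolding S_def[abs_def] by (subst Bochner_Integration.integral_sum) (auto simp: X_integrable mean)
    have "indep_vars (\<lambda>_. borel) X (insert a F)"
      using indep_vars_subset[OF indep] by auto
    then have ind: "indep_var borel (X a) borel (S F)"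
      unfolding S_def[abs_def] using insert by (intro indep_vars_sum) auto
    have cross: "integrable M (\<lambda>x. X a x * S F x)" "expectation (\<lambda>x. X a x * S F x) = 0"
      using indep_var_integrable[OF ind X_integrable iF]
        indep_var_lebesgue_integral[OF ind X_integrable iF] by (auto simp: mF)
    have eq: "(S (insert a F) x)\<^sup>2 = (X a x)\<^sup>2 + 2 * (X a x * S F x) + (S F x)\<^sup>2" for x
      using insert by (simp add: S_def power2_sum)
    show ?case
      unfolding eq using insert cross sq_integrable second_moment
      by (auto simp: algebra_simps)
  qed
  then show "integrable M (\<lambda>x. (S A x)\<^sup>2)" "expectation (\<lambda>x. (S A x)\<^sup>2) = card A * v" by auto
qed

lemma S_chebyshev:
  assumes "finite A" "0 < a"
  shows "prob {x\<in>space M. a \<le> \<bar>S A x\<bar>} \<le> card A * v / a\<^sup>2"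
  using Chebyshev_inequality[OF S_measurable S_moments(3)[OF assms(1)] assms(2)]
    S_moments[OF assms(1)] by simp

text \<open>Along squares Chebyshev's inequality gives a bound of order 1/k^2, which is summable, so
  the first Borel-Cantelli lemma applies with second moments alone. The applications ask only for
  infinitely many indices.\<close>

lemma lln_squares:
  assumes "0 < \<delta>"
  shows "AE x in M. \<forall>\<^sub>F k in sequentially. \<bar>S {..<k\<^sup>2} x\<bar> < \<delta> * (real k)\<^sup>2"
proof -
  \<comment> \<open>The shift to \<open>Suc k\<close> keeps the threshold positive, as
    \<open>S_chebyshev\<close> demands.\<close>
  define A where "A k = {x\<in>space M. \<delta> * (real (Suc k))\<^sup>2 \<le> \<bar>S {..<(Suc k)\<^sup>2} x\<bar>}" for k
  have Am: "A k \<in> events" for k unfolding A_def by measurable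
  have "prob (A k) \<le> v / \<delta>\<^sup>2 * (1 / (real (Suc k))\<^sup>2)" for k
  proof -
    have "prob (A k) \<le> (Suc k)\<^sup>2 * v / (\<delta> * (real (Suc k))\<^sup>2)\<^sup>2"
      unfolding A_def using S_chebyshev[of "{..<(Suc k)\<^sup>2}" "\<delta> * (real (Suc k))\<^sup>2"] assms
      by (simp del: of_nat_Suc)
    also have "\<dots> = v / \<delta>\<^sup>2 * (1 / (real (Suc k))\<^sup>2)"
      using assms unfolding of_nat_power
      by (simp add: divide_simps power_mult_distrib del: of_nat_Suc)
    finally show ?thesis .
  qed
  moreover have "summable (\<lambda>k. v / \<delta>\<^sup>2 * (1 / (real (Suc k))\<^sup>2))"
    using summable_Suc_iff[of "\<lambda>k. 1 / (real k)\<^sup>2"] inverse_power_summable[of 2, where 'a=real]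
    by (intro summable_mult) (simp only: inverse_eq_divide)
  ultimately have "summable (\<lambda>k. prob (A k))"
    by (intro summable_comparison_test_ev[of "\<lambda>k. prob (A k)"]) (auto intro!: always_eventually)
  then have "AE x in M. \<forall>\<^sub>F k in sequentially. x \<in> space M - A k"
    by (intro borel_cantelli_AE1 Am) (auto simp: emeasure_eq_measure)
  then show ?thesis
  proof eventually_elim
    case (elim x)
    then have "\<forall>\<^sub>F k in sequentially. \<bar>S {..<(Suc k)\<^sup>2} x\<bar> < \<delta> * (real (Suc k))\<^sup>2"
      by eventually_elim (auto simp: A_def not_le)
    then show ?case by (subst eventually_sequentially_Suc[symmetric])
  qed
qed

text \<open>By independence the characteristic function of \<open>S A\<close> is the one of
  \<open>X 0\<close> raised to the power \<open>card A\<close>, and Levy's uniqueness theorem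
  applies. This transfers the tail bound for initial segments to any interval of the same
  length.\<close>

lemma S_prob_card:
  assumes "finite A" "finite B" "card A = card B"
  shows "prob {x\<in>space M. z \<le> S A x} = prob {x\<in>space M. z \<le> S B x}"
proof -
  have ch: "char (distr M borel (S A)) t = char (distr M borel (X 0)) t ^ card A" for A t
  proof -
    have "(\<Prod>i\<in>A. char (distr M borel (X i)) t) = (\<Prod>i\<in>A. char (distr M borel (X 0)) t)"
      by (intro prod.cong refl) (subst ident, rule refl)
    then show ?thesis
      using char_distr_sum[OF indep_vars_subset[OF indep], of A t] by (simp add: S_def[abs_def])
  qed
  have "distr M borel (S A) = distr M borel (S B)"
    by (intro Levy_uniqueness ext) (auto simp: ch assms)
  then have "measure (distr M borel (S A)) {z..} = measure (distr M borel (S B)) {z..}" by simp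
  then show ?thesis
    by (simp add: measure_distr vimage_def Int_def conj_commute)
qed

text \<open>Weak convergence controls distribution functions only at continuity points of the limit,
  hence the detour through the null atom at 1.\<close>

lemma clt_tail:
  assumes "0 < v"
  shows "\<exists>p>0. \<forall>\<^sub>F n in sequentially. p \<le> prob {x\<in>space M. sqrt v * sqrt n \<le> S {..<n} x}"
proof -
  interpret N: real_distribution std_normal_distribution by (rule real_dist_normal_dist)
  let ?D = "\<lambda>n. distr M borel (\<lambda>x. S {..<n} x / sqrt (real n * (sqrt v)\<^sup>2))"
  have w: "weak_conv_m ?D std_normal_distribution"
    unfolding S_def
    by (rule central_limit_theorem_zero_mean[OF indep, where \<mu> = "distr M borel (X 0)"])
      (use assms in \<open>auto simp: mean sq_integrable second_moment intro: ident\<close>)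
  have "emeasure std_normal_distribution {1} = 0"
    by (subst emeasure_density) (auto simp: nn_integral_0_iff_AE intro!: AE_I[where N="{1}"])
  then have "isCont (cdf std_normal_distribution) 1"
    by (subst N.isCont_cdf) (simp add: measure_def)
  then have lim: "(\<lambda>n. cdf (?D n) 1) \<longlonglongrightarrow> cdf std_normal_distribution 1"
    using w by (auto simp: weak_conv_m_def weak_conv_def)
  \<comment> \<open>Half of the limiting tail: the slack turns convergence into a bound that holds
    for all large \<open>n\<close>.\<close>
  define p where "p = (1 - cdf std_normal_distribution 1) / 2"
  have p: "p > 0" "cdf std_normal_distribution 1 < 1 - p"
    using std_normal_tail_pos by (auto simp: p_def cdf_def field_simps)
  have "\<forall>\<^sub>F n in sequentially. cdf (?D n) 1 < 1 - p"
    using lim p(2) by (rule order_tendstoD(2))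
  then have "\<forall>\<^sub>F n in sequentially. p \<le> prob {x\<in>space M. sqrt v * sqrt n \<le> S {..<n} x}"
    using eventually_gt_at_top[of 0]
  proof eventually_elim
    case (elim n)
    let ?A = "{x\<in>space M. S {..<n} x / sqrt (real n * (sqrt v)\<^sup>2) \<le> 1}"
    have "cdf (?D n) 1 = prob ?A"
      unfolding cdf_def by (subst measure_distr) (auto intro!: arg_cong[where f=prob])
    moreover have "prob (space M - ?A) = 1 - prob ?A" by (intro prob_compl) measurable
    ultimately have "p \<le> prob (space M - ?A)" using elim by simp
    also have "\<dots> \<le> prob {x\<in>space M. sqrt v * sqrt n \<le> S {..<n} x}"
      using elim assms by (intro finite_measure_mono) (auto simp: field_simps real_sqrt_mult)
    finally show ?case .
  qed
  with p show ?thesis by blast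
qed

lemma S_disjoint_blocks_prob:
  assumes disj: "disjoint_family_on K {..<L::nat}" and fin: "\<And>l. finite (K l)"
    and card: "\<And>l. card (K l) = m"
  shows "prob {x\<in>space M. \<forall>l<L. z \<le> S (K l) x} = prob {x\<in>space M. z \<le> S {..<m} x} ^ L"
\<comment> \<open>\<open>indep_varsD\<close> needs a nonempty index set, so the empty product is
  treated separately.\<close>
proof (cases "L = 0")
  case True then show ?thesis by (simp add: prob_space)
next
  case False
  have "indep_vars (\<lambda>l. Pi\<^sub>M (K l) (\<lambda>_. borel)) (\<lambda>l x. restrict (\<lambda>i. X i x) (K l)) {..<L}"
    by (rule indep_vars_restrict[OF indep _ disj]) auto
  from indep_vars_compose2[OF this, of "\<lambda>l y. \<Sum>i\<in>K l. y i" "\<lambda>_. borel"]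
  have ind: "indep_vars (\<lambda>_. borel) (\<lambda>l. S (K l)) {..<L}"
    by (simp add: S_def[abs_def] cong: sum.cong)
  have "{x\<in>space M. \<forall>l<L. z \<le> S (K l) x} = (\<Inter>l\<in>{..<L}. S (K l) -` {z..} \<inter> space M)"
    using False by auto
  also have "prob \<dots> = (\<Prod>l<L. prob (S (K l) -` {z..} \<inter> space M))"
    using False by (intro indep_varsD[OF ind]) auto
  also have "\<dots> = (\<Prod>l<L. prob {x\<in>space M. z \<le> S (K l) x})"
    by (auto intro!: prod.cong arg_cong[where f=prob])
  also have "\<dots> = (\<Prod>l<L. prob {x\<in>space M. z \<le> S {..<m} x})"
    using S_prob_card[of "K _" "{..<m}" z] by (intro prod.cong refl) (simp add: card fin)
  finally show ?thesis by simp
qed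

text \<open>In the \<open>k\<close>-th block the sum is asked to exceed \<open>sqrt (v * m)\<close> on each of \<open>L\<close> consecutive
  intervals of length \<open>m\<close>. With \<open>L\<close> of order \<open>ln k\<close> this has probability at least \<open>1 / (k + 1)\<close>, and the
  sums add up to order \<open>sqrt (n * L)\<close>, where \<open>L\<close> is of order \<open>ln (ln n)\<close> because \<open>n\<close> is about
  \<open>(k!)\<^sup>4\<close>. What precedes the block is negligible, so no upper bound of iterated logarithm
  type is needed.\<close>

lemma lil_lower_bound:
  assumes "0 < v"
  shows "\<exists>a>0. AE x in M. \<exists>\<^sub>F n in sequentially. a * sqrt (n * ln (ln n)) \<le> S {..<n} x"
proof -
  define \<sigma> where "\<sigma> = sqrt v"
  have \<sigma>: "\<sigma> > 0" "\<sigma>\<^sup>2 = v" using assms by (auto simp: \<sigma>_def)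
  obtain p0 where p0: "p0 > 0"
    "\<forall>\<^sub>F n in sequentially. p0 \<le> prob {x\<in>space M. \<sigma> * sqrt n \<le> S {..<n} x}"
    using clt_tail[OF assms] unfolding \<sigma>_def by blast
  \<comment> \<open>The cap \<open>exp (-1)\<close> forces \<open>ln p \<le> -1\<close>, hence
    \<open>q \<le> 1\<close> and \<open>L k \<le> k\<close>.\<close>
  define p where "p = min p0 (exp (-1))"
  have p: "p > 0" "p \<le> exp (-1)" using p0 by (auto simp: p_def)
  have "ln p \<le> -1" using p ln_mono[of p "exp (-1)"] by simp
  \<comment> \<open>Chosen so that \<open>p\<close> to the power \<open>q * ln (k + 1)\<close>
    equals \<open>1 / (k + 1)\<close>. Rounding the exponent down to \<open>L k\<close> only
    increases the probability, because \<open>p < 1\<close>.\<close>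
  define q where "q = 1 / (- ln p)"
  have q: "0 < q" "q \<le> 1" "q * ln p = -1" using \<open>ln p \<le> -1\<close> by (auto simp: q_def field_simps)
  define L where "L k = nat \<lfloor>q * ln (Suc k)\<rfloor>" for k
  \<comment> \<open>Block \<open>k\<close> starts at \<open>s k\<close>, and
    \<open>s (k + 1) = (k + 1)^4 * s k\<close>. With \<open>m k = (k + 1)^2 * s k\<close> the at
    most \<open>k\<close> intervals of length \<open>m k\<close> end before
    \<open>s (k + 1)\<close>, while \<open>s k / m k = 1 / (k + 1)^2\<close> is summable, which
    makes the past negligible by Chebyshev.\<close>
  define s where "s k = (fact k :: nat) ^ 4" for k
  define m where "m k = (Suc k)\<^sup>2 * s k" for k
  define K where "K k l = {s k + l * m k ..< s k + Suc l * m k}" for k l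
  define J where "J k = {s k ..< s k + L k * m k}" for k
  define E where "E k = {x\<in>space M. \<forall>l<L k. \<sigma> * sqrt (m k) \<le> S (K k l) x}" for k
  \<comment> \<open>The threshold is half the target of one interval. Outside \<open>D k\<close>,
    and with at least one interval, the past cancels at most half of the gain of the block.\<close>
  define D where "D k = {x\<in>space M. \<sigma> * sqrt (m k) / 2 \<le> \<bar>S {..<s k} x\<bar>}" for k

  have s_pos: "s k > 0" for k by (simp add: s_def)
  have m_pos: "m k > 0" for k using s_pos by (simp add: m_def)
  have ln_Suc: "ln (real (Suc k)) \<le> k" for k
    using ln_le_minus_one[of "real (Suc k)"] by simp
  have L_le: "real (L k) \<le> q * ln (Suc k)" for k
    using q by (simp add: L_def)
  have L_le_k: "L k \<le> k" for k
  proof -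
    have "q * ln (Suc k) \<le> 1 * ln (Suc k)" using q by (intro mult_right_mono) auto
    then have "real (L k) \<le> real k" using L_le[of k] ln_Suc[of k] by linarith
    then show ?thesis by simp
  qed
  have s_Suc: "s k + L k * m k \<le> s (Suc k)" for k
  proof -
    have "1 + k * (Suc k)\<^sup>2 \<le> Suc k ^ 4"
      by (simp add: power2_eq_square power4_eq_xxxx algebra_simps)
    moreover have "L k * (Suc k)\<^sup>2 \<le> k * (Suc k)\<^sup>2" using L_le_k[of k] by (intro mult_right_mono) auto
    ultimately have "(1 + L k * (Suc k)\<^sup>2) * s k \<le> Suc k ^ 4 * s k" by (intro mult_right_mono) linarith+
    moreover have "s (Suc k) = Suc k ^ 4 * s k"
      unfolding s_def fact_Suc of_nat_id power_mult_distrib ..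
    ultimately show ?thesis by (simp add: m_def algebra_simps del: power_Suc)
  qed
  have s_mono: "s j \<le> s k" if "j \<le> k" for j k
    unfolding s_def by (intro power_mono fact_mono_nat that) auto
  have k_le_m: "k \<le> m k" for k
  proof -
    have "k * 1 \<le> (Suc k)\<^sup>2 * s k"
      using s_pos[of k] by (intro mult_le_mono) (auto simp: power2_eq_square)
    then show ?thesis by (simp add: m_def)
  qed

  have "disjoint_family J"
  proof -
    have "J j \<inter> J k = {}" if "j < k" for j k
      using s_Suc[of j] s_mono[of "Suc j" k] that by (auto simp: J_def)
    then show ?thesis
      by (auto simp: disjoint_family_on_def) (metis disjoint_iff linorder_neqE_nat)
  qed
  \<comment> \<open>Each block variable lives in its own product space; this is why
    \<open>borel_cantelli_2\<close> lets the target space depend on the index.\<close>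
  then have indJ: "indep_vars (\<lambda>k. Pi\<^sub>M (J k) (\<lambda>_. borel)) (\<lambda>k x. restrict (\<lambda>i. X i x) (J k)) UNIV"
    by (intro indep_vars_restrict[OF indep]) auto
  have K_J: "K k l \<subseteq> J k" if "l < L k" for k l
  proof -
    have "Suc l * m k \<le> L k * m k" using that by (intro mult_right_mono) auto
    then show ?thesis by (auto simp: K_def J_def)
  qed
  have K_disj: "disjoint_family_on (K k) {..<L k}" for k
  proof -
    have "K k j \<inter> K k l = {}" if "j < l" for j l
    proof -
      have "Suc j * m k \<le> l * m k" using that by (intro mult_right_mono) auto
      then show ?thesis by (auto simp: K_def)
    qed
    then show ?thesis
      by (auto simp: disjoint_family_on_def) (metis disjoint_iff linorder_neqE_nat)
  qed

  have L_large: "\<forall>\<^sub>F k in sequentially. q / 2 * ln (Suc k) \<le> L k \<and> 1 \<le> L k"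
  proof -
    have "filterlim (\<lambda>k. ln (real (Suc k))) at_top sequentially"
      by (intro filterlim_compose[OF ln_at_top] filterlim_compose[OF filterlim_real_sequentially]
          filterlim_Suc)
    then have "\<forall>\<^sub>F k in sequentially. 2 / q \<le> ln (real (Suc k))"
      by (simp add: filterlim_at_top)
    then show ?thesis
    proof eventually_elim
      case (elim k)
      then have "2 \<le> q * ln (Suc k)" using q by (simp add: field_simps)
      moreover have "real (L k) = of_int \<lfloor>q * ln (Suc k)\<rfloor>"
        using calculation by (simp add: L_def)
      ultimately have "q * ln (Suc k) - 1 \<le> L k" "1 \<le> real (L k)" "2 \<le> q * ln (Suc k)"
        by linarith+
      then show ?case by (simp add: field_simps)
    qed
  qed

  have E_ge: "\<forall>\<^sub>F k in sequentially. 1 / real (Suc k) \<le> prob (E k)"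
  proof -
    have "filterlim m at_top sequentially"
      by (rule filterlim_at_top_mono[OF filterlim_ident]) (use k_le_m in auto)
    then have "\<forall>\<^sub>F k in sequentially. p0 \<le> prob {x\<in>space M. \<sigma> * sqrt (m k) \<le> S {..<m k} x}"
      using p0(2) by (rule eventually_compose_filterlim[rotated])
    then show ?thesis
    proof eventually_elim
      case (elim k)
      have "1 / real (Suc k) = exp (- ln (Suc k))" by (simp add: exp_minus inverse_eq_divide)
      also have "\<dots> \<le> exp (L k * ln p)"
      proof -
        have "q * ln (Suc k) * ln p \<le> L k * ln p"
          using L_le[of k] \<open>ln p \<le> -1\<close> by (intro mult_right_mono_neg) auto
        moreover have "q * ln (Suc k) * ln p = (q * ln p) * ln (Suc k)" by (simp only: mult_ac)
        ultimately show ?thesis using q(3) by simp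
      qed
      also have "\<dots> = p ^ L k" using p by (simp add: exp_of_nat_mult)
      also have "\<dots> \<le> prob {x\<in>space M. \<sigma> * sqrt (m k) \<le> S {..<m k} x} ^ L k"
        using elim p by (intro power_mono) (auto simp: p_def)
      also have "\<dots> = prob (E k)"
        unfolding E_def by (rule S_disjoint_blocks_prob[symmetric, OF K_disj]) (auto simp: K_def)
      finally show ?case .
    qed
  qed
  have nsum: "\<not> summable (\<lambda>k. prob (E k))"
  proof
    assume "summable (\<lambda>k. prob (E k))"
    moreover have "\<forall>\<^sub>F k in sequentially. norm (1 / real (Suc k)) \<le> prob (E k)"
      using E_ge by eventually_elim simp
    ultimately have "summable (\<lambda>k. 1 / real (Suc k))"
      by (rule summable_comparison_test_ev[rotated])
    then have "summable (\<lambda>k. inverse (real k))"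
      using summable_Suc_iff[of "\<lambda>k. inverse (real k)"] by (simp only: inverse_eq_divide)
    then show False using not_summable_harmonic[where 'a=real] by simp
  qed
  \<comment> \<open>The event \<open>E k\<close> expressed through the coordinates in
    \<open>J k\<close> alone, so that the events are independent over \<open>k\<close>.\<close>
  define A where "A k = {y \<in> space (Pi\<^sub>M (J k) (\<lambda>_. borel :: real measure)).
      \<forall>l\<in>{..<L k}. \<sigma> * sqrt (m k) \<le> (\<Sum>i\<in>K k l. y i)}" for k
  have A_sets: "A k \<in> sets (Pi\<^sub>M (J k) (\<lambda>_. borel))" for k
    unfolding A_def
  proof (rule sets.sets_Collect_finite_All)
    fix l assume l: "l \<in> {..<L k}"
    have [measurable]: "(\<lambda>y. \<Sum>i\<in>K k l. y i) \<in> borel_measurable (Pi\<^sub>M (J k) (\<lambda>_. borel :: real measure))"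
      using K_J[of l k] l by (intro borel_measurable_sum measurable_component_singleton) auto
    show "{y \<in> space (Pi\<^sub>M (J k) (\<lambda>_. borel)). \<sigma> * sqrt (m k) \<le> (\<Sum>i\<in>K k l. y i)}
        \<in> sets (Pi\<^sub>M (J k) (\<lambda>_. borel))"
      by measurable
  qed simp
  have A_E: "restrict (\<lambda>i. X i x) (J k) \<in> A k \<longleftrightarrow> x \<in> E k" if "x \<in> space M" for x k
  proof -
    have "(\<Sum>i\<in>K k l. restrict (\<lambda>i. X i x) (J k) i) = S (K k l) x" if "l < L k" for l
      unfolding S_def using K_J[OF that] by (intro sum.cong) auto
    then show ?thesis using that by (auto simp: A_def E_def space_PiM)
  qed
  have "AE x in M. \<exists>\<^sub>F k in sequentially. restrict (\<lambda>i. X i x) (J k) \<in> A k"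
  proof (rule borel_cantelli_2[OF indJ A_sets])
    have "(\<lambda>x. restrict (\<lambda>i. X i x) (J k)) -` A k \<inter> space M = E k" for k
      using A_E by (auto simp: E_def)
    then show "\<not> summable (\<lambda>k. prob ((\<lambda>x. restrict (\<lambda>i. X i x) (J k)) -` A k \<inter> space M))"
      using nsum by simp
  qed
  with AE_space have E_io: "AE x in M. \<exists>\<^sub>F k in sequentially. x \<in> E k"
    by eventually_elim (simp add: A_E)

  have "prob (D k) \<le> 4 * (1 / (real (Suc k))\<^sup>2)" for k
  proof -
    have "prob (D k) \<le> s k * v / (\<sigma> * sqrt (m k) / 2)\<^sup>2"
      unfolding D_def using S_chebyshev[of "{..<s k}" "\<sigma> * sqrt (m k) / 2"] \<sigma> m_pos by simp
    also have "\<dots> = 4 * (real (s k) / real (m k))"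
      using assms \<sigma> m_pos[of k] by (simp add: power_mult_distrib power_divide)
    also have "real (s k) / real (m k) = 1 / (real (Suc k))\<^sup>2"
      using s_pos[of k] by (simp add: m_def del: of_nat_Suc)
    finally show ?thesis .
  qed
  moreover have "summable (\<lambda>k. 4 * (1 / (real (Suc k))\<^sup>2))"
    using summable_Suc_iff[of "\<lambda>k. 1 / (real k)\<^sup>2"] inverse_power_summable[of 2, where 'a=real]
    by (intro summable_mult) (simp only: inverse_eq_divide)
  ultimately have "summable (\<lambda>k. prob (D k))"
    by (intro summable_comparison_test_ev[of "\<lambda>k. prob (D k)"]) (auto intro!: always_eventually)
  then have D_ev: "AE x in M. \<forall>\<^sub>F k in sequentially. x \<in> space M - D k"
    by (intro borel_cantelli_AE1) (auto simp: emeasure_eq_measure D_def)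

  \<comment> \<open>Made up of S >= \<sigma>/2 * L * sqrt m, n <= 2 * L * m and ln (ln n) <= 8/q *
    L. The last two give sqrt (n * ln (ln n)) <= 4 * L * sqrt m / sqrt q, and
    \<open>a * 4 / sqrt q = \<sigma> / 2\<close>.\<close>
  define a where "a = \<sigma> * sqrt q / 8"
  have step: "a * sqrt (n * ln (ln n)) \<le> S {..<n} x"
    if n: "n = s k + L k * m k" and x: "x \<in> E k" "x \<in> space M - D k"
      and k: "q / 2 * ln (Suc k) \<le> L k" "1 \<le> L k" "2 \<le> k" for n k x
  proof -
    let ?L = "real (L k)" and ?r = "sqrt (m k)"
    have "(\<Sum>l<L k. S (K k l) x) = S (\<Union>l<L k. K k l) x"
      unfolding S_def using K_disj[of k]
      by (intro sum.UNION_disjoint[symmetric]) (auto simp: K_def disjoint_family_on_def)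
    also have "(\<Union>l<L k. K k l) = J k"
    proof
      show "J k \<subseteq> (\<Union>l<L k. K k l)"
      proof
        fix i assume i: "i \<in> J k"
        define l where "l = (i - s k) div m k"
        have "i - s k < L k * m k" using i by (auto simp: J_def)
        then have "l < L k" unfolding l_def by (simp add: less_mult_imp_div_less)
        moreover have "l * m k \<le> i - s k" "i - s k < Suc l * m k"
          using dividend_less_times_div[OF m_pos, of "i - s k" k]
          by (auto simp: l_def algebra_simps)
        then have "i \<in> K k l" using i by (auto simp: K_def J_def)
        ultimately show "i \<in> (\<Union>l<L k. K k l)" by blast
      qed
    qed (use K_J in auto)
    finally have SJ: "S (J k) x = (\<Sum>l<L k. S (K k l) x)" by simp
    have "S {..<n} x = S {..<s k} x + S (J k) x"
    proof -
      have "{..<n} = {..<s k} \<union> J k" by (auto simp: n J_def)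
      then show ?thesis
        unfolding S_def by (simp add: sum.union_disjoint J_def disjoint_iff)
    qed
    moreover have "(\<Sum>l<L k. S (K k l) x) \<ge> (\<Sum>l<L k. \<sigma> * ?r)"
      using x by (intro sum_mono) (auto simp: E_def)
    moreover have "- (\<sigma> * ?r / 2) \<le> S {..<s k} x" using x by (auto simp: D_def)
    ultimately have "S {..<n} x \<ge> ?L * (\<sigma> * ?r) - \<sigma> * ?r / 2" using SJ by simp
    moreover have "\<sigma> * ?r / 2 \<le> ?L * (\<sigma> * ?r) / 2"
      using mult_right_mono[of 1 ?L "\<sigma> * ?r"] \<sigma> k by simp
    moreover have "\<sigma> / 2 * (?L * ?r) = ?L * (\<sigma> * ?r) - ?L * (\<sigma> * ?r) / 2"
      by (simp add: field_simps)
    ultimately have S_ge: "S {..<n} x \<ge> \<sigma> / 2 * (?L * ?r)" by linarith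

    have n_pos: "n \<ge> 3"
    proof -
      have "3 \<le> (Suc k)\<^sup>2 * s k"
        using k(3) s_pos[of k] power_mono[of 2 "Suc k" 2] by (simp add: Suc_leI order_trans[of 3 "(Suc k)\<^sup>2"] del: power_Suc)
      also have "\<dots> \<le> L k * m k" using k(2) by (simp add: m_def)
      finally show ?thesis by (simp add: n)
    qed
    have "s k \<le> m k" by (simp add: m_def)
    also have "m k \<le> L k * m k" using k by simp
    finally have "n \<le> 2 * L k * m k" unfolding n by simp
    then have n_le: "real n \<le> 2 * ?L * m k" by (metis of_nat_le_iff of_nat_mult of_nat_numeral)
    have "1 < ln (real n)"
      using ln3_gt_1 ln_le_cancel_iff[of 3 "real n"] n_pos by linarith
    \<comment> \<open>A crude bound on the factorial is enough: it makes \<open>ln n\<close> at most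
      \<open>(k + 1)^4\<close>, so \<open>ln (ln n)\<close> is at most
      \<open>4 * ln (k + 1)\<close>, which is comparable to \<open>L k\<close>.\<close>
    have "n \<le> (Suc k ^ Suc k) ^ 4"
    proof -
      have "s (Suc k) \<le> (Suc k ^ Suc k) ^ 4"
        unfolding s_def using fact_le_power[of "Suc k", where 'a=nat]
        by (intro power_mono) (auto simp del: power_Suc)
      then show ?thesis using s_Suc[of k] n by linarith
    qed
    then have "ln n \<le> ln (real ((Suc k ^ Suc k) ^ 4))" using n_pos by (subst ln_le_cancel_iff) (auto simp del: of_nat_power)
    also have "\<dots> = 4 * (real (Suc k) * ln (Suc k))"
      by (simp add: ln_realpow del: power_Suc of_nat_Suc)
    also have "\<dots> \<le> 4 * (real (Suc k) * real (Suc k))"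
      using ln_Suc[of k] by (intro mult_left_mono) auto
    also have "\<dots> \<le> real (Suc k) ^ 4"
    proof -
      have "2 * 2 \<le> real (Suc k) * real (Suc k)" using k by (intro mult_mono) auto
      then have "4 * (real (Suc k) * real (Suc k)) \<le> (real (Suc k) * real (Suc k)) * (real (Suc k) * real (Suc k))"
        by (intro mult_right_mono) auto
      then show ?thesis by (simp add: power4_eq_xxxx mult.assoc del: of_nat_Suc)
    qed
    finally have "ln (ln n) \<le> ln (real (Suc k) ^ 4)"
      using \<open>1 < ln (real n)\<close> by (subst ln_le_cancel_iff) auto
    also have "\<dots> = 4 * ln (Suc k)" by (simp add: ln_realpow del: of_nat_Suc)
    also have "\<dots> \<le> 8 / q * ?L" using k(1) q(1) by (simp add: field_simps)
    finally have "n * ln (ln n) \<le> (2 * ?L * m k) * (8 / q * ?L)"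
      using n_le \<open>1 < ln (real n)\<close> by (intro mult_mono) auto
    also have "\<dots> = (4 * ?L * ?r / sqrt q)\<^sup>2"
      using q by (simp add: power_mult_distrib power_divide) (simp add: power2_eq_square)
    finally have "sqrt (n * ln (ln n)) \<le> 4 * ?L * ?r / sqrt q"
      using q by (intro real_le_lsqrt) auto
    then have "a * sqrt (n * ln (ln n)) \<le> a * (4 * ?L * ?r / sqrt q)"
      using \<sigma> q by (intro mult_left_mono) (auto simp: a_def)
    also have "\<dots> = \<sigma> / 2 * (?L * ?r)" using q by (simp add: a_def)
    finally show ?thesis using S_ge by linarith
  qed
  have "AE x in M. \<exists>\<^sub>F n in sequentially. a * sqrt (n * ln (ln n)) \<le> S {..<n} x"
    using E_io D_ev
  proof eventually_elim
    case (elim x)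
    have ev: "\<forall>\<^sub>F k in sequentially. x \<in> space M - D k \<and>
        (q / 2 * ln (Suc k) \<le> L k \<and> 1 \<le> L k) \<and> 2 \<le> k"
      using elim(2) L_large eventually_ge_at_top[of 2] by eventually_elim simp
    have "\<exists>n\<ge>n0. a * sqrt (n * ln (ln n)) \<le> S {..<n} x" for n0
    proof -
      obtain k where k: "k \<ge> n0" "x \<in> E k" "x \<in> space M - D k"
        "q / 2 * ln (Suc k) \<le> L k" "1 \<le> L k" "2 \<le> k"
        using frequently_eventually_frequently[OF elim(1) eventually_conj[OF ev eventually_ge_at_top[of n0]]]
        by (auto dest: frequently_ex)
      have "n0 \<le> s k + L k * m k"
        using k(1,5) k_le_m[of k] by (metis le_trans mult_le_mono nat_mult_1 trans_le_add2 le_refl)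
      then show ?thesis using step[OF refl k(2-)] by blast
    qed
    then show ?case by (simp add: frequently_sequentially)
  qed
  moreover have "a > 0" using \<sigma> q by (simp add: a_def)
  ultimately show ?thesis by blast
qed

end

section \<open>Coordinates of random sequences\<close>

lemma (in prob_space) prob_space_P_H: "prob_space (P_H M)"
  unfolding P_H_def by (intro prob_space_PiM prob_space_axioms)

lemma (in prob_space) distr_P_H: "distr (P_H M) M (\<lambda>w. w i) = M"
  unfolding P_H_def by (intro distr_PiM_component prob_space_axioms) simp

lemma measurable_P_H: "(\<lambda>w. w i) \<in> measurable (P_H M) M"
  unfolding P_H_def by measurable

lemma (in prob_space) indep_vars_P_H: "prob_space.indep_vars (P_H M) (\<lambda>_. M) (\<lambda>i w. w i) UNIV"
proof -
  interpret P: prob_space "P_H M" by (rule prob_space_P_H)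
  have "distr (P_H M) (Pi\<^sub>M UNIV (\<lambda>_. M)) (\<lambda>w. \<lambda>i\<in>UNIV. w i) = distr (P_H M) (P_H M) (\<lambda>w. w)"
    by (simp add: P_H_def restrict_UNIV)
  also have "\<dots> = (\<Pi>\<^sub>M i\<in>UNIV. distr (P_H M) M (\<lambda>w. w i))"
    by (simp add: distr_P_H) (simp add: P_H_def)
  finally show ?thesis
    by (subst P.indep_vars_iff_distr_eq_PiM') (auto intro: measurable_P_H)
qed

lemma (in prob_space) expectation_P_H:
  fixes g :: "'a \<Rightarrow> real"
  assumes [measurable]: "g \<in> borel_measurable M"
  shows "prob_space.expectation (P_H M) (\<lambda>w. g (w i)) = expectation g"
proof -
  have "expectation g = integral\<^sup>L (distr (P_H M) M (\<lambda>w. w i)) g" by (simp add: distr_P_H)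
  also have "\<dots> = integral\<^sup>L (P_H M) (\<lambda>w. g (w i))" by (rule integral_distr[OF measurable_P_H assms])
  finally show ?thesis by simp
qed

lemma (in prob_space) iid_centered_P_H:
  fixes g :: "'a \<Rightarrow> real"
  assumes [measurable]: "g \<in> borel_measurable M"
    and bdd: "\<And>x. x \<in> space M \<Longrightarrow> \<bar>g x\<bar> \<le> B" and mean: "expectation g = 0"
  shows "iid_centered (P_H M) (\<lambda>i w. g (w i))"
proof -
  interpret P: prob_space "P_H M" by (rule prob_space_P_H)
  have gm: "(\<lambda>w. g (w i)) \<in> borel_measurable (P_H M)" for i
    by (rule measurable_compose[OF measurable_P_H assms(1)])
  show ?thesis
  proof (rule iid_centered.intro[OF P.prob_space_axioms iid_centered_axioms.intro])
    show "P.indep_vars (\<lambda>_. borel) (\<lambda>i w. g (w i)) UNIV"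
      using P.indep_vars_compose2[OF indep_vars_P_H, of "\<lambda>_. g" "\<lambda>_. borel"] assms(1) by blast
    have "distr (P_H M) borel (\<lambda>w. g (w i)) = distr M borel g" for i
    proof -
      have "distr (P_H M) borel (\<lambda>w. g (w i)) = distr (distr (P_H M) M (\<lambda>w. w i)) borel g"
        unfolding distr_distr[OF assms(1) measurable_P_H] comp_def ..
      then show ?thesis by (simp only: distr_P_H)
    qed
    then show "distr (P_H M) borel (\<lambda>w. g (w n)) = distr (P_H M) borel (\<lambda>w. g (w 0))" for n
      by (simp only:)
    show "integrable (P_H M) (\<lambda>w. (g (w 0))\<^sup>2)"
    proof (rule P.integrable_const_bound[where B = "B\<^sup>2"])
      show "AE w in P_H M. norm ((g (w 0))\<^sup>2) \<le> B\<^sup>2"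
      proof (rule AE_I2)
        fix w assume "w \<in> space (P_H M)"
        then have "w 0 \<in> space M" by (auto simp: P_H_def space_PiM)
        then show "norm ((g (w 0))\<^sup>2) \<le> B\<^sup>2"
          using power_mono[OF bdd[of "w 0"], of 2] by simp
      qed
    qed (rule borel_measurable_power[OF gm])
    show "P.expectation (\<lambda>w. g (w 0)) = 0" using expectation_P_H[OF assms(1)] mean by simp
  qed
qed

text \<open>At \<open>m = k^2\<close> the sum eventually differs from \<open>m\<close> times the
  mean by less than half of it, so it exceeds half the mean times \<open>m\<close>. It is applied to
  \<open>X t\<close> for packing and to \<open>- X t\<close> for Hausdorff measures.\<close>

lemma (in prob_space) P_H_sums_unbounded:
  fixes g :: "'a \<Rightarrow> real"
  assumes [measurable]: "g \<in> borel_measurable M"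
    and bdd: "\<And>x. x \<in> space M \<Longrightarrow> \<bar>g x\<bar> \<le> B" and mean: "0 < expectation g"
  shows "AE w in P_H M. \<forall>K n0. \<exists>m\<ge>n0. K \<le> (\<Sum>i<m. g (w i))"
proof -
  let ?e = "expectation g"
  have int: "integrable M g" using bdd by (intro integrable_const_bound[where B = B]) auto
  interpret iid: iid_centered "P_H M" "\<lambda>i w. g (w i) - ?e"
  proof (rule iid_centered_P_H[where B = "B + ?e"])
    show "\<bar>g x - ?e\<bar> \<le> B + ?e" if "x \<in> space M" for x using bdd[OF that] mean by linarith
    show "expectation (\<lambda>x. g x - ?e) = 0" using int by (simp add: prob_space)
  qed simp
  have "AE w in P_H M. \<forall>\<^sub>F k in sequentially. \<bar>iid.S {..<k\<^sup>2} w\<bar> < ?e / 2 * (real k)\<^sup>2"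
    using mean by (intro iid.lln_squares) simp
  then show ?thesis
  proof eventually_elim
    case (elim w)
    show ?case
    proof (intro allI)
      fix K :: real and n0 :: nat
      have "filterlim (\<lambda>k. ?e / 2 * real k) at_top sequentially"
        using mean by (intro filterlim_tendsto_pos_mult_at_top[OF tendsto_const] filterlim_real_sequentially) auto
      then have "\<forall>\<^sub>F k in sequentially. K \<le> ?e / 2 * real k" by (simp add: filterlim_at_top)
      then have "\<forall>\<^sub>F k in sequentially. n0 \<le> k\<^sup>2 \<and> K \<le> (\<Sum>i<k\<^sup>2. g (w i))"
        using elim eventually_ge_at_top[of "max 1 n0"]
      proof eventually_elim
        case (elim k)
        have k: "k \<le> k\<^sup>2" by (simp add: power2_eq_square)
        have "iid.S {..<k\<^sup>2} w = (\<Sum>i<k\<^sup>2. g (w i)) - (real k)\<^sup>2 * ?e"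
          by (simp add: iid.S_def sum_subtractf)
        then have "?e / 2 * (real k)\<^sup>2 \<le> (\<Sum>i<k\<^sup>2. g (w i))"
          using elim(2) unfolding abs_less_iff by (simp add: mult.commute)
        moreover have "?e / 2 * real k \<le> ?e / 2 * (real k)\<^sup>2"
          using mean k by (intro mult_left_mono) (auto simp flip: of_nat_power)
        ultimately show ?case using elim k by auto
      qed
      then show "\<exists>m\<ge>n0. K \<le> (\<Sum>i<m. g (w i))"
        using eventually_happens[of _ sequentially] by fastforce
    qed
  qed
qed

section \<open>Packings and similarities\<close>

text \<open>The inclusion that is not immediate is surjectivity: rescaled and recentred, the map is
  an isometry fixing 0, hence orthogonal, hence onto.\<close>

lemma similarity_image_ball:
  fixes g :: "'a::euclidean_space \<Rightarrow> 'a"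
  assumes "\<And>x y. norm (g x - g y) = r * norm (x - y)" and "0 < r"
  shows "g ` ball x \<rho> = ball (g x) (r * \<rho>)"
proof -
  define T where "T z = (1 / r) *\<^sub>R (g (x + z) - g x)" for z
  have "orthogonal_transformation T"
    unfolding orthogonal_transformation_isometry
  proof (intro conjI allI)
    show "T 0 = 0" by (simp add: T_def)
    fix y z
    have "T y - T z = (1 / r) *\<^sub>R (g (x + y) - g (x + z))"
      by (simp add: T_def algebra_simps)
    then show "dist (T y) (T z) = dist y z"
      using assms by (simp add: dist_norm)
  qed
  then have surj: "surj T" by (rule orthogonal_transformation_surj)
  show ?thesis
  proof
    show "g ` ball x \<rho> \<subseteq> ball (g x) (r * \<rho>)"
      using assms by (auto simp: dist_norm)
    show "ball (g x) (r * \<rho>) \<subseteq> g ` ball x \<rho>"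
    proof
      fix y assume y: "y \<in> ball (g x) (r * \<rho>)"
      obtain z where z: "(1 / r) *\<^sub>R (y - g x) = T z" using surj by (metis surjD)
      then have gz: "y = g (x + z)"
        using assms(2) by (simp add: T_def)
      have "r * norm z < r * \<rho>"
        using y assms(1)[of x "x + z"] by (simp add: gz dist_norm)
      then have "x + z \<in> ball x \<rho>"
        using assms(2) by (simp add: dist_norm)
      then show "y \<in> g ` ball x \<rho>" using gz by blast
    qed
  qed
qed

text \<open>After rescaling by \<open>1 / r\<close> the points lie in a fixed compact ball. Finitely
  many balls of radius \<open>\<rho> / 2\<close> cover it, and each is assigned at most one point.
  The bound does not depend on the scale \<open>r\<close>.\<close>

lemma separated_points_bound:
  fixes R :: real
  assumes "0 < \<rho>"
  obtains M where "0 < M" "\<And>(p :: 'i \<Rightarrow> 'a::euclidean_space) I y r. 0 < r \<Longrightarrow>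
    (\<And>i. i \<in> I \<Longrightarrow> dist y (p i) \<le> R * r) \<Longrightarrow>
    (\<And>i j. i \<in> I \<Longrightarrow> j \<in> I \<Longrightarrow> i \<noteq> j \<Longrightarrow> \<rho> * r \<le> dist (p i) (p j)) \<Longrightarrow>
    finite I \<and> card I \<le> M"
proof -
  have "x \<in> (\<Union>x\<in>UNIV. ball x (\<rho> / 2))" for x :: 'a
    using assms by (intro UN_I[of x]) auto
  then have "cball (0::'a) R \<subseteq> (\<Union>x\<in>UNIV. ball x (\<rho> / 2))" by blast
  then obtain K where K: "finite K" "cball (0::'a) R \<subseteq> (\<Union>x\<in>K. ball x (\<rho> / 2))"
    using compactE_image[of "cball (0::'a) R" UNIV "\<lambda>x. ball x (\<rho> / 2)"] by auto
  have "finite I \<and> card I \<le> Suc (card K)"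
    if r: "0 < r" and d: "\<And>i. i \<in> I \<Longrightarrow> dist y (p i) \<le> R * r"
      and sep: "\<And>i j. i \<in> I \<Longrightarrow> j \<in> I \<Longrightarrow> i \<noteq> j \<Longrightarrow> \<rho> * r \<le> dist (p i) (p j)"
    for p :: "'i \<Rightarrow> 'a" and I y r
  proof -
    define q where "q i = (1 / r) *\<^sub>R (p i - y)" for i
    have "\<exists>x. x \<in> K \<and> dist x (q i) < \<rho> / 2" if "i \<in> I" for i
    proof -
      have "norm (q i) \<le> R" using d[OF that] r
        by (simp add: q_def dist_norm norm_minus_commute pos_divide_le_eq)
      then have "q i \<in> cball 0 R" by simp
      then have "q i \<in> (\<Union>x\<in>K. ball x (\<rho> / 2))" using K(2) by blast
      then show ?thesis by auto
    qed
    then obtain \<kappa> where \<kappa>: "\<And>i. i \<in> I \<Longrightarrow> \<kappa> i \<in> K \<and> dist (\<kappa> i) (q i) < \<rho> / 2" by metis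
    have "inj_on \<kappa> I"
    proof (rule inj_onI, rule ccontr)
      fix i j assume ij: "i \<in> I" "j \<in> I" "\<kappa> i = \<kappa> j" "i \<noteq> j"
      have "dist (q i) (q j) < \<rho>"
        using \<kappa>[OF ij(1)] \<kappa>[OF ij(2)] ij(3) dist_triangle_half_r[of "\<kappa> i" "q i" \<rho> "q j"] by auto
      moreover have "dist (q i) (q j) = dist (p i) (p j) / r"
        using r by (simp add: q_def dist_norm flip: scaleR_diff_right)
      ultimately show False using sep[OF ij(1,2,4)] r by (simp add: field_simps)
    qed
    moreover have "\<kappa> ` I \<subseteq> K" using \<kappa> by auto
    ultimately show ?thesis
      using K(1) by (meson card_inj_on_le inj_on_finite le_SucI)
  qed
  then show thesis by (intro that[of "Suc (card K)"]) auto
qed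

text \<open>A maximal independent set dominates: its neighbourhoods, each of size at most
  \<open>M\<close>, cover \<open>W\<close>.\<close>

lemma bounded_degree_independent_subset:
  assumes "finite W" "\<And>u. u \<in> W \<Longrightarrow> r u u"
    and deg: "\<And>u. u \<in> W \<Longrightarrow> card {v\<in>W. r u v} \<le> M"
    and sym: "\<And>u v. r u v \<Longrightarrow> r v u"
  obtains I where "I \<subseteq> W" "card W \<le> M * card I"
    "\<And>u v. u \<in> I \<Longrightarrow> v \<in> I \<Longrightarrow> u \<noteq> v \<Longrightarrow> \<not> r u v"
proof -
  define P where "P I \<longleftrightarrow> I \<subseteq> W \<and> (\<forall>u\<in>I. \<forall>v\<in>I. u \<noteq> v \<longrightarrow> \<not> r u v)" for I
  have "finite {I. P I}" by (rule finite_subset[of _ "Pow W"]) (auto simp: P_def assms(1))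
  moreover have "P {}" by (simp add: P_def)
  ultimately obtain I where I: "P I" "\<And>J. P J \<Longrightarrow> I \<subseteq> J \<Longrightarrow> J = I"
    using finite_has_maximal[of "{I. P I}"] by auto
  have "W \<subseteq> (\<Union>u\<in>I. {v\<in>W. r u v})"
  proof
    fix v assume v: "v \<in> W"
    show "v \<in> (\<Union>u\<in>I. {v\<in>W. r u v})"
    proof (rule ccontr)
      assume n: "v \<notin> (\<Union>u\<in>I. {v\<in>W. r u v})"
      then have "P (insert v I)" using v I(1) sym by (auto simp: P_def)
      then have "insert v I = I" using I(2) by blast
      then show False using n v assms(2) by blast
    qed
  qed
  moreover have fin: "finite I" using I(1) assms(1) finite_subset by (auto simp: P_def)
  ultimately have "card W \<le> card (\<Union>u\<in>I. {v\<in>W. r u v})"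
    using assms(1) by (intro card_mono) auto
  also have "\<dots> \<le> (\<Sum>u\<in>I. card {v\<in>W. r u v})" by (rule card_UN_le[OF fin])
  also have "\<dots> \<le> (\<Sum>u\<in>I. M)" using I(1) deg by (intro sum_mono) (auto simp: P_def)
  finally have "card W \<le> M * card I" by (simp add: mult.commute)
  with I(1) show thesis by (intro that[of I]) (auto simp: P_def)
qed

lemma packing_premeasure_at_ge:
  assumes "finite I" "\<And>i. i \<in> I \<Longrightarrow> x i \<in> G" "0 < r" "r \<le> \<delta>"
    and sep: "\<And>i j. i \<in> I \<Longrightarrow> j \<in> I \<Longrightarrow> i \<noteq> j \<Longrightarrow> 2 * r < dist (x i) (x j)"
  shows "of_nat (card I) * ennreal (h (2 * r)) \<le> packing_premeasure_at h \<delta> G"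
proof -
  let ?B = "(\<lambda>i. (x i, r)) ` I"
  have inj: "inj_on (\<lambda>i. (x i, r)) I"
    using sep assms(3) by (intro inj_onI) (metis Pair_inject dist_self mult_pos_pos not_less_iff_gr_or_eq zero_less_numeral)
  have "?B \<in> packings \<delta> G"
  proof -
    have "cball (x i) r \<inter> cball (x j) r = {}" if "i \<in> I" "j \<in> I" "i \<noteq> j" for i j
    proof -
      have False if "dist (x i) z \<le> r" "dist (x j) z \<le> r" for z
        using sep[OF \<open>i \<in> I\<close> \<open>j \<in> I\<close> \<open>i \<noteq> j\<close>] that dist_triangle2[of "x i" "x j" z] by linarith
      then show ?thesis by auto
    qed
    then have "disjoint_family_on (\<lambda>(x, r). cball x r) ?B"
      unfolding disjoint_family_on_def by (auto simp: image_iff)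
    then show ?thesis using assms by (auto simp: packings_def countable_finite)
  qed
  then have "(\<Sum>\<^sub>\<infinity>(x, r)\<in>?B. ennreal (h (2 * r))) \<le> packing_premeasure_at h \<delta> G"
    unfolding packing_premeasure_at_def by (intro SUP_upper)
  also have "(\<Sum>\<^sub>\<infinity>(x, r)\<in>?B. ennreal (h (2 * r))) = (\<Sum>i\<in>I. ennreal (h (2 * r)))"
    using assms(1) by (simp add: infsum_finite sum.reindex[OF inj])
  finally show ?thesis by simp
qed

section \<open>Attractors of a fixed parameter sequence\<close>

text \<open>If no covering set were dense in a relatively open piece of \<open>F\<close>, the sets
  \<open>F - closure (G i)\<close> would be relatively open and dense with empty intersection,
  against Baire's theorem.\<close>

lemma packing_measure_eq_top:
  assumes "closed F" "F \<noteq> {}"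
    and loc: "\<And>G x \<delta>. x \<in> F \<Longrightarrow> 0 < \<delta> \<Longrightarrow> F \<inter> ball x \<delta> \<subseteq> closure G \<Longrightarrow> packing_premeasure h G = \<infinity>"
  shows "packing_measure h F = \<infinity>"
proof -
  have "(\<Sum>i. packing_premeasure h (G i)) = \<infinity>" if G: "F \<subseteq> (\<Union>i::nat. G i)" for G
  proof -
    have "\<exists>i. \<exists>x\<in>F. \<exists>\<delta>>0. F \<inter> ball x \<delta> \<subseteq> closure (G i)"
    proof (rule ccontr)
      assume n: "\<not> ?thesis"
      define T where "T i = F - closure (G i)" for i
      have "F \<subseteq> closure (\<Inter>(range T))"
      proof (rule Baire[OF assms(1)])
        fix A assume "A \<in> range T"
        then obtain i where A: "A = T i" by blast
        have "F \<subseteq> closure (T i)"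
        proof
          fix x assume "x \<in> F"
          then have "\<exists>y\<in>T i. dist y x < \<delta>" if "\<delta> > 0" for \<delta>
            using n that unfolding T_def by (force simp: dist_commute)
          then show "x \<in> closure (T i)" by (simp add: closure_approachable)
        qed
        moreover have "openin (top_of_set F) (T i)"
          unfolding T_def by (simp add: Diff_eq openin_open_Int open_Compl)
        ultimately show "openin (top_of_set F) A \<and> F \<subseteq> closure A" by (simp add: A)
      qed simp
      moreover have "\<Inter>(range T) = {}"
      proof (rule equals0I)
        fix y assume y: "y \<in> \<Inter>(range T)"
        then have "y \<in> F" by (auto simp: T_def)
        then obtain i where "y \<in> closure (G i)" using G closure_subset by blast
        with y show False by (auto simp: T_def)
      qed
      ultimately show False using assms(2) by simp
    qed
    then obtain i where "packing_premeasure h (G i) = \<infinity>" using loc by blast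
    moreover have "packing_premeasure h (G i) \<le> (\<Sum>i. packing_premeasure h (G i))"
      using sum_le_suminf[of "\<lambda>i. packing_premeasure h (G i)" "{i}"] by simp
    ultimately show ?thesis by (simp add: top_unique)
  qed
  then show ?thesis
    unfolding packing_measure_def by (intro antisym INF_greatest) auto
qed

text \<open>Disjoint balls in a bounded region have bounded total volume, and the extra power of the
  radius contributes a factor \<open>\<delta>\<close>. This makes the set in the definition of
  \<open>packing_dim\<close> nonempty, without which its infimum could not be bounded below.\<close>

lemma packing_measure_powr_Suc_DIM_eq_0:
  fixes F :: "'a::euclidean_space set"
  assumes "bounded F"
  shows "packing_measure (\<lambda>u. u powr real (Suc DIM('a))) F = 0"
proof -
  let ?d = "DIM('a)" and ?h = "\<lambda>u::real. u powr real (Suc DIM('a))"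
  obtain R where R: "\<And>x. x \<in> F \<Longrightarrow> norm x \<le> R" using assms by (auto simp: bounded_iff)
  let ?V = "cball (0::'a) (R + 1)"
  define K where "K = 2 ^ Suc ?d * measure lborel ?V / unit_ball_vol ?d"
  have K: "K \<ge> 0" by (simp add: K_def)
  have fin: "(\<Sum>(x, r)\<in>A. ennreal (?h (2 * r))) \<le> ennreal (\<delta> * K)"
    if \<delta>: "0 < \<delta>" "\<delta> \<le> 1" and B: "B \<in> packings \<delta> F" and A: "finite A" "A \<subseteq> B" for \<delta> A B
  proof -
    have r: "x \<in> F" "0 < r" "r \<le> \<delta>" if "(x, r) \<in> A" for x r
      using B A that by (auto simp: packings_def)
    have disj: "disjoint_family_on (\<lambda>(x, r). cball x r) A"
      using B A disjoint_family_on_mono by (auto simp: packings_def)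
    have "(\<Sum>(x, r)\<in>A. measure lborel (cball x r)) = measure lborel (\<Union>(x, r)\<in>A. cball x r)"
      using A(1) disj
      by (subst measure_finite_Union) (auto simp: case_prod_unfold emeasure_lborel_cball_finite[THEN less_imp_neq, simplified])
    also have "\<dots> \<le> measure lborel ?V"
    proof (rule measure_mono_fmeasurable)
      show "(\<Union>(x, r)\<in>A. cball x r) \<subseteq> ?V"
      proof safe
        fix x y :: 'a and r assume "(x, r) \<in> A" "y \<in> cball x r"
        then show "y \<in> ?V"
          using r[of x r] R[of x] \<delta> norm_triangle_sub[of y x] by (auto simp: dist_norm norm_minus_commute)
      qed
    qed (use A(1) in \<open>auto intro!: fmeasurableI simp: emeasure_lborel_cball_finite[simplified]\<close>)
    finally have vol: "(\<Sum>(x, r)\<in>A. measure lborel (cball x r)) \<le> measure lborel ?V" .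
    have "(\<Sum>(x, r)\<in>A. ?h (2 * r)) \<le> (\<Sum>(x, r)\<in>A. \<delta> * 2 ^ Suc ?d / unit_ball_vol ?d * measure lborel (cball x r))"
    proof (intro sum_mono, safe)
      fix x :: 'a and r assume xr: "(x, r) \<in> A"
      have "?h (2 * r) = 2 ^ Suc ?d * (r * r ^ ?d)"
        using r[OF xr] by (subst powr_realpow) (auto simp: power_mult_distrib)
      also have "\<dots> \<le> 2 ^ Suc ?d * (\<delta> * r ^ ?d)"
        using r[OF xr] by (intro mult_left_mono mult_right_mono) auto
      also have "\<dots> = \<delta> * 2 ^ Suc ?d / unit_ball_vol ?d * (unit_ball_vol ?d * r ^ ?d)"
        using less_imp_neq[OF unit_ball_vol_pos[of "real ?d"]] by simp
      finally show "?h (2 * r) \<le> \<delta> * 2 ^ Suc ?d / unit_ball_vol ?d * measure lborel (cball x r)"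
        using r[OF xr] by (simp only: content_cball measure_completion borel_closed closed_cball sets_lborel less_imp_le)
    qed
    also have "\<dots> = \<delta> * 2 ^ Suc ?d / unit_ball_vol ?d * (\<Sum>(x, r)\<in>A. measure lborel (cball x r))"
      by (simp add: sum_distrib_left case_prod_unfold)
    also have "\<dots> \<le> \<delta> * 2 ^ Suc ?d / unit_ball_vol ?d * measure lborel ?V"
      using vol \<delta> by (intro mult_left_mono) auto
    also have "\<dots> = \<delta> * K" by (simp add: K_def)
    finally have "(\<Sum>(x, r)\<in>A. ?h (2 * r)) \<le> \<delta> * K" .
    moreover have "(\<Sum>(x, r)\<in>A. ennreal (?h (2 * r))) = ennreal (\<Sum>(x, r)\<in>A. ?h (2 * r))"
      by (simp add: case_prod_unfold)
    ultimately show ?thesis by (simp add: ennreal_leI)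
  qed
  have at: "packing_premeasure_at ?h \<delta> F \<le> ennreal (\<delta> * K)" if \<delta>: "0 < \<delta>" "\<delta> \<le> 1" for \<delta>
    unfolding packing_premeasure_at_def
  proof (rule SUP_least)
    fix B assume "B \<in> packings \<delta> F"
    then show "(\<Sum>\<^sub>\<infinity>(x, r)\<in>B. ennreal (?h (2 * r))) \<le> ennreal (\<delta> * K)"
      using fin[OF \<delta>] by (subst nonneg_infsum_complete) (auto intro!: SUP_least)
  qed
  have "packing_premeasure ?h F \<le> ennreal e" if "e > 0" for e
  proof -
    define \<delta> where "\<delta> = min 1 (e / (K + 1))"
    have "\<delta> * (K + 1) \<le> e / (K + 1) * (K + 1)"
      using K by (intro mult_right_mono) (auto simp: \<delta>_def)
    then have \<delta>: "0 < \<delta>" "\<delta> \<le> 1" "\<delta> * (K + 1) \<le> e"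
      using that K by (auto simp: \<delta>_def)
    have "packing_premeasure ?h F \<le> packing_premeasure_at ?h \<delta> F"
      unfolding packing_premeasure_def using \<delta> by (intro INF_lower) auto
    also have "\<dots> \<le> ennreal (\<delta> * K)" by (rule at[OF \<delta>(1,2)])
    also have "\<dots> \<le> ennreal e" using \<delta> by (intro ennreal_leI) (simp add: algebra_simps)
    finally show ?thesis .
  qed
  then have "packing_premeasure ?h F \<le> 0 + ennreal e" if "e > 0" for e
    using that by (simp only: add_0_left)
  then have "packing_premeasure ?h F \<le> 0" by (rule ennreal_le_epsilon)
  then have "packing_premeasure ?h F = 0" by simp
  then have "(\<Sum>i::nat. packing_premeasure ?h F) = 0" by simp
  then show ?thesis
    unfolding packing_measure_def by (intro antisym INF_lower2[of "\<lambda>_. F"]) auto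
qed

lemma compose_maps_cong: "(\<And>i. i < k \<Longrightarrow> j i = j' i) \<Longrightarrow> compose_maps f w j k = compose_maps f w j' k"
  by (induction k) auto

text \<open>Randomness enters only through \<open>w\<close>, so the geometry is done for one fixed
  sequence with a single ratio \<open>r i\<close> per level.\<close>

locale homogeneous_ifs =
  fixes N :: "'k \<Rightarrow> nat" and f :: "'k \<Rightarrow> nat \<Rightarrow> 'a::euclidean_space \<Rightarrow> 'a"
    and \<Delta> U :: "'a set" and w :: "nat \<Rightarrow> 'k" and r :: "nat \<Rightarrow> real" and cmax :: real
  assumes N_pos: "1 \<le> N (w i)"
    and r_pos: "0 < r i" and r_le: "r i \<le> cmax" and cmax: "cmax < 1"
    and similarity: "j \<in> {1..N (w i)} \<Longrightarrow> norm (f (w i) j x - f (w i) j y) = r i * norm (x - y)"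
    and Delta: "compact \<Delta>" "\<Delta> \<noteq> {}" "j \<in> {1..N (w i)} \<Longrightarrow> f (w i) j ` \<Delta> \<subseteq> \<Delta>"
    and U: "U \<noteq> {}" "open U" "j \<in> {1..N (w i)} \<Longrightarrow> f (w i) j ` U \<subseteq> U"
      "j \<in> {1..N (w i)} \<Longrightarrow> j' \<in> {1..N (w i)} \<Longrightarrow> j \<noteq> j' \<Longrightarrow> f (w i) j ` U \<inter> f (w i) j' ` U = {}"
begin

definition words :: "nat \<Rightarrow> (nat \<Rightarrow> nat) set" where
  "words k = {j. \<forall>i<k. j i \<in> {1..N (w i)}}"

text \<open>Membership in \<open>words k\<close> constrains only the first \<open>k\<close> letters,
  so that a word can be reused at every level; \<open>W k\<close> holds the extensional
  representatives, which are finite in number and can be counted.\<close>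

definition W :: "nat \<Rightarrow> (nat \<Rightarrow> nat) set" where
  "W k = (\<Pi>\<^sub>E i\<in>{..<k}. {1..N (w i)})"

abbreviation "cyl \<equiv> compose_maps f w"

definition P :: "nat \<Rightarrow> real" where "P k = (\<Prod>i<k. real (N (w i)))"

definition C :: "nat \<Rightarrow> real" where "C k = (\<Prod>i<k. r i)"

abbreviation "F \<equiv> homogeneous_attractor N f \<Delta> w"

section \<open>Cylinders and levels of a single realisation\<close>

lemma P_pos: "0 < P k"
  unfolding P_def using N_pos by (intro prod_pos) (metis of_nat_0_less_iff less_le_trans zero_less_one)

lemma C_pos: "0 < C k"
  unfolding C_def using r_pos by (intro prod_pos) auto

lemma cmax_pos: "0 < cmax"
  using r_pos[of 0] r_le[of 0] by linarith

lemma C_le: "C k \<le> cmax ^ k"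
proof -
  have "C k \<le> (\<Prod>i<k. cmax)"
    unfolding C_def using r_pos r_le by (intro prod_mono) (auto intro: less_imp_le)
  then show ?thesis by simp
qed

lemma C_le_1: "C k \<le> 1"
  using C_le[of k] power_le_one[of cmax k] cmax_pos cmax by linarith

lemma C_tendsto: "C \<longlonglongrightarrow> 0"
proof (rule tendsto_sandwich[of "\<lambda>_. 0" _ _ "\<lambda>k. cmax ^ k"])
  show "(\<lambda>k. cmax ^ k) \<longlonglongrightarrow> 0" using cmax cmax_pos by (intro LIMSEQ_realpow_zero) auto
qed (auto intro!: always_eventually less_imp_le[OF C_pos] C_le)

lemma C_scaled_small:
  assumes "0 < \<delta>"
  shows "\<exists>n0. \<forall>k\<ge>n0. C k * D < \<delta>"
proof -
  have "(\<lambda>k. C k * D) \<longlonglongrightarrow> 0" using tendsto_mult_left_zero[OF C_tendsto] .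
  then have "\<forall>\<^sub>F k in sequentially. C k * D < \<delta>" using assms by (rule order_tendstoD)
  then show ?thesis by (simp add: eventually_sequentially)
qed

lemma W_words: "j \<in> W k \<Longrightarrow> j \<in> words k"
  unfolding W_def words_def by (simp add: PiE_iff)

lemma words_mono: "j \<in> words m \<Longrightarrow> k \<le> m \<Longrightarrow> j \<in> words k"
  by (auto simp: words_def)

lemma finite_W: "finite (W k)"
  unfolding W_def by (intro finite_PiE) auto

lemma card_W: "real (card (W k)) = P k"
  by (simp add: W_def P_def card_PiE)

lemma cyl_similarity:
  "j \<in> words k \<Longrightarrow> norm (cyl j k x - cyl j k y) = C k * norm (x - y)"
proof (induction k arbitrary: x y)
  case 0 then show ?case by (simp add: C_def)
next
  case (Suc k)
  then have "j \<in> words k" "j k \<in> {1..N (w k)}" by (auto simp: words_def)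
  then show ?case using Suc.IH similarity by (simp add: C_def)
qed

text \<open>Stated for any invariant set because it serves both \<open>\<Delta>\<close> and
  \<open>U\<close>.\<close>

lemma cyl_image_mono:
  assumes "\<And>i j. j \<in> {1..N (w i)} \<Longrightarrow> f (w i) j ` X \<subseteq> X" "j \<in> words m" "k \<le> m"
  shows "cyl j m ` X \<subseteq> cyl j k ` X"
  using assms(3,2)
proof (induction m rule: dec_induct)
  case (step m)
  then have "j m \<in> {1..N (w m)}" "j \<in> words m" by (auto simp: words_def)
  then have "cyl j m ` (f (w m) (j m) ` X) \<subseteq> cyl j m ` X"
    using assms(1) by (intro image_mono) auto
  then have "cyl j (Suc m) ` X \<subseteq> cyl j m ` X" by (simp add: image_comp)
  then show ?case using step.IH \<open>j \<in> words m\<close> by blast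
qed simp

lemma compact_cyl:
  assumes "j \<in> words k" shows "compact (cyl j k ` \<Delta>)"
proof (rule compact_continuous_image[OF _ Delta(1)])
  have "(C k)-lipschitz_on \<Delta> (cyl j k)"
    using cyl_similarity[OF assms] C_pos[of k] by (intro lipschitz_onI) (auto simp: dist_norm)
  then show "continuous_on \<Delta> (cyl j k)" by (rule lipschitz_on_continuous_on)
qed

text \<open>Continuing the word by the letter 1, which is always available, yields nested nonempty
  compact sets; a common point lies in the attractor.\<close>

lemma cylinder_meets_attractor:
  assumes "j \<in> words m"
  shows "\<exists>y\<in>F. y \<in> cyl j m ` \<Delta>"
proof -
  define j' where "j' i = (if i < m then j i else 1)" for i
  have j': "j' \<in> words k" for k using assms N_pos by (auto simp: words_def j'_def)
  have "\<Inter>(range (\<lambda>k. cyl j' k ` \<Delta>)) \<noteq> {}"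
    using compact_cyl[OF j'] Delta(2) cyl_image_mono[OF Delta(3) j']
    by (intro compact_nest) auto
  then obtain y where "y \<in> (\<Inter>k. cyl j' k ` \<Delta>)" by (metis ex_in_conv)
  then have y: "y \<in> cyl j' k ` \<Delta>" for k unfolding INT_iff by (rule bspec) (rule UNIV_I)
  have "y \<in> F"
    unfolding homogeneous_attractor_def words_def[symmetric]
    by (rule INT_I, rule UN_I[where a=j'], rule j', rule y)
  moreover have "cyl j' m = cyl j m" by (intro compose_maps_cong) (simp add: j'_def)
  ultimately show ?thesis using y[of m] by auto
qed

lemma level_eq: "(\<Union>j\<in>{j. \<forall>i<k. j i \<in> {1..N (w i)}}. cyl j k ` \<Delta>) = (\<Union>j\<in>W k. cyl j k ` \<Delta>)"
  unfolding words_def[symmetric]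
proof (intro equalityI subsetI)
  fix y assume "y \<in> (\<Union>j\<in>words k. cyl j k ` \<Delta>)"
  then obtain j where j: "j \<in> words k" "y \<in> cyl j k ` \<Delta>" by (rule UN_E)
  have "cyl (restrict j {..<k}) k = cyl j k" by (intro compose_maps_cong) simp
  moreover have "restrict j {..<k} \<in> W k"
    using j(1) unfolding W_def words_def by (simp add: PiE_iff)
  ultimately show "y \<in> (\<Union>j\<in>W k. cyl j k ` \<Delta>)"
    using j(2) by (intro UN_I[of "restrict j {..<k}"]) simp_all
next
  fix y assume "y \<in> (\<Union>j\<in>W k. cyl j k ` \<Delta>)"
  then obtain j where "j \<in> W k" "y \<in> cyl j k ` \<Delta>" by (rule UN_E)
  then show "y \<in> (\<Union>j\<in>words k. cyl j k ` \<Delta>)"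
    by (intro UN_I[of j]) (simp_all add: W_words)
qed

lemma attractor_eq: "F = (\<Inter>k\<in>{1..}. \<Union>j\<in>W k. cyl j k ` \<Delta>)"
  unfolding homogeneous_attractor_def level_eq ..

lemma attractor_cover: "1 \<le> k \<Longrightarrow> F \<subseteq> (\<Union>j\<in>W k. cyl j k ` \<Delta>)"
  unfolding attractor_eq by auto

lemma compact_level: "compact (\<Union>j\<in>W k. cyl j k ` \<Delta>)"
  using compact_cyl W_words finite_W by (intro compact_UN) auto

lemma closed_attractor: "closed F"
  unfolding attractor_eq by (intro closed_INT ballI compact_imp_closed compact_level)

lemma bounded_attractor: "bounded F"
  by (rule bounded_subset[OF compact_imp_bounded[OF compact_level] attractor_cover[OF order_refl]])

lemma attractor_nonempty: "F \<noteq> {}"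
  using cylinder_meets_attractor[of "\<lambda>_. 1" 0] by (auto simp: words_def)

text \<open>Either the words differ before the last letter, and the images shrink inside disjoint
  ones, or the common prefix map is injective and transports the disjointness of the last
  step.\<close>

lemma cyl_disjoint:
  assumes "j \<in> words k" "j' \<in> words k" "i < k" "j i \<noteq> j' i"
  shows "cyl j k ` U \<inter> cyl j' k ` U = {}"
  using assms
proof (induction k arbitrary: i)
  case (Suc k)
  show ?case
  proof (cases "\<exists>l<k. j l \<noteq> j' l")
    case True
    then obtain l where l: "l < k" "j l \<noteq> j' l" by blast
    have im: "cyl z (Suc k) ` U \<subseteq> cyl z k ` U" if "z \<in> words (Suc k)" for z
      by (rule cyl_image_mono[OF U(3) that]) simp_all
    have "cyl j (Suc k) ` U \<inter> cyl j' (Suc k) ` U \<subseteq> cyl j k ` U \<inter> cyl j' k ` U"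
      by (rule Int_mono[OF im[OF Suc.prems(1)] im[OF Suc.prems(2)]])
    also have "\<dots> = {}"
      using l words_mono[OF Suc.prems(1)] words_mono[OF Suc.prems(2)] by (intro Suc.IH) simp_all
    finally show ?thesis by (simp only: subset_empty)
  next
    case False
    then have eq: "cyl j' k = cyl j k" by (intro compose_maps_cong) auto
    have ik: "i = k" using False Suc.prems by (auto simp: less_Suc_eq)
    have "inj (cyl j k)"
    proof (rule injI)
      fix x y assume "cyl j k x = cyl j k y"
      then show "x = y"
        using cyl_similarity[of j k x y] Suc.prems C_pos[of k] words_mono[of j "Suc k" k] by simp
    qed
    moreover have "f (w k) (j k) ` U \<inter> f (w k) (j' k) ` U = {}"
      using Suc.prems ik by (intro U(4)) (auto simp: words_def)
    moreover have "cyl j (Suc k) ` U = cyl j k ` f (w k) (j k) ` U"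
      "cyl j' (Suc k) ` U = cyl j k ` f (w k) (j' k) ` U"
      by (simp_all add: image_comp eq)
    ultimately show ?thesis
      by (metis image_Int image_empty)
  qed
qed simp

text \<open>The ball of radius \<open>\<rho> * C k\<close> about one centre is the full image of
  \<open>ball x0 \<rho>\<close>, hence lies in an image of \<open>U\<close> disjoint from the one
  that contains the other centre.\<close>

lemma cyl_separated:
  assumes "ball x0 \<rho> \<subseteq> U" "j \<in> W k" "j' \<in> W k" "j \<noteq> j'" "0 < \<rho>"
  shows "\<rho> * C k \<le> dist (cyl j k x0) (cyl j' k x0)"
proof (rule ccontr)
  assume "\<not> ?thesis"
  then have "cyl j' k x0 \<in> ball (cyl j k x0) (C k * \<rho>)" by (simp add: mult.commute)
  also have "\<dots> = cyl j k ` ball x0 \<rho>"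
    using similarity_image_ball[OF cyl_similarity[OF W_words[OF assms(2)]] C_pos] by metis
  finally have "cyl j' k x0 \<in> cyl j k ` U" using assms(1) by blast
  moreover have "cyl j' k x0 \<in> cyl j' k ` U" using assms(1,5) by (auto intro!: imageI)
  moreover obtain i where "i < k" "j i \<noteq> j' i"
  proof -
    have "\<exists>i\<in>{..<k}. j i \<noteq> j' i"
      using assms(2-4) unfolding W_def by (metis PiE_ext)
    then show thesis using that by auto
  qed
  ultimately show False using cyl_disjoint[OF W_words[OF assms(2)] W_words[OF assms(3)]] by blast
qed

text \<open>A cylinder of level \<open>n\<close> at \<open>x\<close> fits into the given ball and
  contains the proportion \<open>1 / P n\<close> of all cylinders of level \<open>m\<close>. A
  further factor \<open>1 / M\<close> is lost in making the chosen points of \<open>G\<close> more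
  than \<open>C m\<close> apart. Both losses are independent of \<open>m\<close>.\<close>

lemma packing_premeasure_eq_top:
  assumes x: "x \<in> F" "0 < \<delta>0" and G: "F \<inter> ball x \<delta>0 \<subseteq> closure G"
    and h: "\<And>K n0. \<exists>m\<ge>n0. K \<le> P m * h (C m)"
  shows "packing_premeasure h G = \<infinity>"
proof -
  obtain x0 where x0: "x0 \<in> U" using U(1) by blast
  then obtain \<rho> where \<rho>: "0 < \<rho>" "ball x0 \<rho> \<subseteq> U" using U(2) by (auto simp: open_contains_ball)
  \<comment> \<open>\<open>x0\<close> is adjoined to \<open>\<Delta>\<close> because it may lie
    outside; one constant then bounds all distances inside a cylinder.\<close>
  obtain D where D: "\<And>y. y \<in> insert x0 \<Delta> \<Longrightarrow> norm y \<le> D / 2"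
    using compact_imp_bounded[OF compact_insert[OF Delta(1)]] 
    by (metis bounded_iff mult.commute nonzero_mult_div_cancel_left zero_neq_numeral)
  have D: "dist y z \<le> D" if "y \<in> insert x0 \<Delta>" "z \<in> insert x0 \<Delta>" for y z
    using D[OF that(1)] D[OF that(2)] norm_triangle_ineq4[of y z] by (simp add: dist_norm)
  \<comment> \<open>The radius \<open>D + 2\<close> consists of \<open>D\<close> for the cylinder, 1
    for the passage from the attractor to \<open>G\<close>, and 1 for the distance between two
    neighbouring points.\<close>
  obtain M where M: "0 < M" "\<And>(p :: (nat \<Rightarrow> nat) \<Rightarrow> 'a) I y s. 0 < s \<Longrightarrow>
    (\<And>i. i \<in> I \<Longrightarrow> dist y (p i) \<le> (D + 2) * s) \<Longrightarrow>
    (\<And>i j. i \<in> I \<Longrightarrow> j \<in> I \<Longrightarrow> i \<noteq> j \<Longrightarrow> \<rho> * s \<le> dist (p i) (p j)) \<Longrightarrow>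
    finite I \<and> card I \<le> M"
    using separated_points_bound[OF \<rho>(1), where R = "D + 2"] by metis
  obtain n where n: "1 \<le> n" "C n * D < \<delta>0"
    using C_scaled_small[OF x(2), of D] by (metis nat_le_linear)
  obtain j0 where j0: "j0 \<in> W n" "x \<in> cyl j0 n ` \<Delta>" using attractor_cover[OF n(1)] x(1) by blast
  have cyl_diam: "dist (cyl j k y) (cyl j k z) \<le> C k * D"
    if "j \<in> words k" "y \<in> insert x0 \<Delta>" "z \<in> insert x0 \<Delta>" for j k y z
    using cyl_similarity[OF that(1)] D[OF that(2,3)] C_pos[of k] by (simp add: dist_norm)

  have main: "ennreal K \<le> packing_premeasure_at h \<delta> G" if \<delta>: "0 < \<delta>" for K \<delta>
  proof -
    obtain n1 where n1: "\<And>k. n1 \<le> k \<Longrightarrow> C k * 1 < \<delta>" using C_scaled_small[OF \<delta>] by blast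
    \<comment> \<open>\<open>max 1 K\<close> makes the left side positive and thereby forces
      \<open>h (C m) > 0\<close> for a gauge of which no sign is known. The factor
      \<open>P n * M\<close> anticipates the two losses.\<close>
    obtain m where m: "m \<ge> max n n1" "max 1 K * (P n * M) \<le> P m * h (C m)" using h by blast
    \<comment> \<open>The words of length \<open>m\<close> that continue \<open>j0\<close>.\<close>
    define V where "V = (\<Pi>\<^sub>E i\<in>{..<m}. if i < n then {j0 i} else {1..N (w i)})"
    have V_W: "V \<subseteq> W m"
      unfolding V_def W_def using W_words[OF j0(1)] by (intro PiE_mono) (simp add: words_def)
    have V_j0: "cyl j n = cyl j0 n" if "j \<in> V" for j
    proof (rule compose_maps_cong)
      fix i assume "i < n"
      moreover have "j i \<in> (if i < n then {j0 i} else {1..N (w i)})"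
        using that[unfolded V_def] by (rule PiE_mem) (use \<open>i < n\<close> m(1) in simp)
      ultimately show "j i = j0 i" by simp
    qed
    have finV: "finite V" using V_W finite_W finite_subset by blast
    have "real (card V) * P n = P m"
    proof -
      have "real (card V) = (\<Prod>i<m. if i < n then 1 else real (N (w i)))"
        unfolding V_def by (subst card_PiE) (auto intro!: prod.cong)
      moreover have "P n = (\<Prod>i<m. if i < n then real (N (w i)) else 1)"
      proof -
        have "{..<m} \<inter> {i. i < n} = {..<n}" using m(1) by auto
        then show ?thesis unfolding P_def by (simp add: prod.If_cases)
      qed
      ultimately show ?thesis
        unfolding P_def[of m] by (auto simp: prod.distrib[symmetric] intro!: prod.cong)
    qed
    have "\<exists>z\<in>G. dist z (cyl j m x0) \<le> (D + 1) * C m" if "j \<in> V" for j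
    proof -
      have jm: "j \<in> words m" using that V_W W_words by blast
      then obtain y where y: "y \<in> F" "y \<in> cyl j m ` \<Delta>" using cylinder_meets_attractor by blast
      have "y \<in> cyl j n ` \<Delta>"
        using y(2) cyl_image_mono[OF Delta(3) jm] m(1) by (meson max.boundedE subsetD)
      then have "y \<in> cyl j0 n ` \<Delta>" using V_j0[OF that] by simp
      then have "dist x y \<le> C n * D" using j0 cyl_diam[OF W_words[OF j0(1)]] by auto
      then have "y \<in> closure G" using G y(1) n(2) by auto
      then obtain z where z: "z \<in> G" "dist z y < C m" using C_pos closure_approachable by blast
      moreover have "dist y (cyl j m x0) \<le> C m * D" using y(2) cyl_diam[OF jm] by auto
      ultimately have "dist z (cyl j m x0) \<le> C m * D + C m"
        using dist_triangle[of z "cyl j m x0" y] by linarith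
      then show ?thesis using z(1) by (auto simp: algebra_simps)
    qed
    then obtain z where z: "\<And>j. j \<in> V \<Longrightarrow> z j \<in> G"
      "\<And>j. j \<in> V \<Longrightarrow> dist (z j) (cyl j m x0) \<le> (D + 1) * C m" by metis
    have deg: "card {v \<in> V. dist (z u) (z v) \<le> C m} \<le> M" if "u \<in> V" for u
    proof -
      have "finite {v \<in> V. dist (z u) (z v) \<le> C m} \<and> card {v \<in> V. dist (z u) (z v) \<le> C m} \<le> M"
      proof (rule M(2)[OF C_pos, where p = "\<lambda>j. cyl j m x0"])
        fix v assume v: "v \<in> {v \<in> V. dist (z u) (z v) \<le> C m}"
        then show "dist (z u) (cyl v m x0) \<le> (D + 2) * C m"
          using z(2)[of v] dist_triangle[of "z u" "cyl v m x0" "z v"] by (simp add: algebra_simps)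
      next
        fix i j assume "i \<in> {v \<in> V. dist (z u) (z v) \<le> C m}"
          "j \<in> {v \<in> V. dist (z u) (z v) \<le> C m}" "i \<noteq> j"
        then show "\<rho> * C m \<le> dist (cyl i m x0) (cyl j m x0)"
          using V_W \<rho> by (intro cyl_separated) auto
      qed
      then show ?thesis ..
    qed
    obtain I where I: "I \<subseteq> V" "card V \<le> M * card I"
      "\<And>u v. u \<in> I \<Longrightarrow> v \<in> I \<Longrightarrow> u \<noteq> v \<Longrightarrow> \<not> dist (z u) (z v) \<le> C m"
      using bounded_degree_independent_subset[OF finV, of "\<lambda>u v. dist (z u) (z v) \<le> C m" M]
        deg C_pos[of m] by (auto simp: dist_commute)
    have hpos: "0 < h (C m)"
    proof -
      have "0 < max 1 K * (P n * M)" using P_pos M(1) by (intro mult_pos_pos) auto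
      then show ?thesis using m(2) P_pos[of m] by (metis less_le_trans zero_less_mult_pos)
    qed
    have "K * (P n * M) \<le> P m * h (C m)"
    proof (rule order_trans[OF mult_right_mono m(2)])
      show "0 \<le> P n * M" using P_pos[of n] by simp
    qed simp
    also have "\<dots> = real (card V) * P n * h (C m)" using \<open>real (card V) * P n = P m\<close> by simp
    also have "\<dots> \<le> real (M * card I) * P n * h (C m)"
      using I(2) P_pos[of n] hpos by (intro mult_right_mono) (auto simp del: of_nat_mult)
    finally have "K * (P n * M) \<le> (card I * h (C m)) * (P n * M)" by (simp add: algebra_simps)
    then have "K \<le> card I * h (C m)"
      using P_pos[of n] M(1) by (simp add: mult_le_cancel_right)
    then have "ennreal K \<le> of_nat (card I) * ennreal (h (2 * (C m / 2)))"
      using hpos by (simp add: ennreal_mult'[symmetric] ennreal_of_nat_eq_real_of_nat ennreal_leI)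
    also have "\<dots> \<le> packing_premeasure_at h \<delta> G"
    proof (rule packing_premeasure_at_ge)
      show "finite I" using I(1) finV finite_subset by blast
      show "z i \<in> G" if "i \<in> I" for i using that I(1) z(1) by blast
      show "0 < C m / 2" "C m / 2 \<le> \<delta>" using C_pos[of m] n1[of m] m(1) by auto
      show "2 * (C m / 2) < dist (z i) (z j)" if "i \<in> I" "j \<in> I" "i \<noteq> j" for i j
        using I(3)[OF that] by simp
    qed
    finally show ?thesis .
  qed
  have "packing_premeasure_at h \<delta> G = \<infinity>" if "0 < \<delta>" for \<delta>
  proof (cases "packing_premeasure_at h \<delta> G" rule: ennreal_cases)
    case (real q)
    then show ?thesis using main[OF that, of "q + 1"] by simp
  qed simp
  then show ?thesis unfolding packing_premeasure_def by (simp add: image_constant_conv cong: INF_cong)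
qed

theorem packing_measure_attractor_eq_top:
  assumes "\<And>K n0. \<exists>m\<ge>n0. K \<le> P m * h (C m)"
  shows "packing_measure h F = \<infinity>"
  by (rule packing_measure_eq_top[OF closed_attractor attractor_nonempty])
    (rule packing_premeasure_eq_top[OF _ _ _ assms])

lemma hausdorff_measure_attractor_eq_0:
  assumes t: "0 < t" and small: "\<And>e n0. 0 < e \<Longrightarrow> \<exists>m\<ge>n0. P m * C m powr t \<le> e"
  shows "hausdorff_measure t F = 0"
proof -
  let ?D = "diameter \<Delta>"
  have D: "0 \<le> ?D" by (rule diameter_ge_0[OF compact_imp_bounded[OF Delta(1)]])
  have "hausdorff_premeasure t \<delta> F \<le> ennreal e" if \<delta>: "0 < \<delta>" and e: "0 < e" for \<delta> e
  proof -
    obtain n1 where n1: "\<And>k. n1 \<le> k \<Longrightarrow> C k * ?D < \<delta>" using C_scaled_small[OF \<delta>] by blast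
    \<comment> \<open>The added 1 avoids division by zero when \<open>\<Delta>\<close> is a single
      point.\<close>
    have "0 < e / (?D powr t + 1)" using e by (intro divide_pos_pos add_nonneg_pos) auto
    then obtain m where m: "m \<ge> max 1 n1" "P m * C m powr t \<le> e / (?D powr t + 1)"
      using small by blast
    obtain g where g: "bij_betw g {..<card (W m)} (W m)"
      using ex_bij_betw_nat_finite[OF finite_W] by (auto simp: atLeast0LessThan)
    \<comment> \<open>The premeasure takes covers indexed by all naturals, so the finite cover is
      padded with empty sets, which contribute 0.\<close>
    define A where "A i = (if i < card (W m) then cyl (g i) m ` \<Delta> else {})" for i
    have gW: "g i \<in> W m" if "i < card (W m)" for i using g that by (auto simp: bij_betw_def)
    have diam: "diameter (A i) \<le> C m * ?D" for i
    proof (cases "i < card (W m)")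
      case True
      show ?thesis
      proof (rule diameter_le)
        fix x y assume "x \<in> A i" "y \<in> A i"
        then obtain a b where ab: "a \<in> \<Delta>" "b \<in> \<Delta>" "x = cyl (g i) m a" "y = cyl (g i) m b"
          using True by (auto simp: A_def)
        have "norm (a - b) \<le> ?D"
          using diameter_bounded_bound[OF compact_imp_bounded[OF Delta(1)] ab(1,2)] by (simp add: dist_norm)
        then show "norm (x - y) \<le> C m * ?D"
          using ab cyl_similarity[OF W_words[OF gW[OF True]]] C_pos[of m] by simp
      qed (use C_pos[of m] D in simp)
    qed (use C_pos[of m] D in \<open>simp add: A_def\<close>)
    have bnd: "bounded (A i)" for i
      using compact_imp_bounded[OF compact_cyl[OF W_words[OF gW]]] by (auto simp: A_def)
    have "F \<subseteq> (\<Union>i. A i)"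
    proof
      fix x assume "x \<in> F"
      then obtain j where j: "j \<in> W m" "x \<in> cyl j m ` \<Delta>" using attractor_cover[of m] m(1) by auto
      moreover from this have "j \<in> g ` {..<card (W m)}" using g by (simp add: bij_betw_def)
      ultimately obtain i where "i < card (W m)" "g i = j" by auto
      then show "x \<in> (\<Union>i. A i)" using j by (intro UN_I[of i]) (simp_all add: A_def)
    qed
    then have "hausdorff_premeasure t \<delta> F \<le> (\<Sum>i. ennreal (diameter (A i) powr t))"
      unfolding hausdorff_premeasure_def
      using bnd order_trans[OF diam less_imp_le[OF n1]] m(1) by (intro INF_lower) auto
    also have "\<dots> = (\<Sum>i<card (W m). ennreal (diameter (A i) powr t))"
      by (intro suminf_finite) (auto simp: A_def)
    also have "\<dots> \<le> (\<Sum>i<card (W m). ennreal ((C m * ?D) powr t))"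
      using t bnd diam by (intro sum_mono ennreal_leI powr_mono2) (auto intro: diameter_ge_0)
    also have "\<dots> = ennreal (P m * (C m * ?D) powr t)"
      by (simp add: card_W[symmetric] ennreal_mult ennreal_of_nat_eq_real_of_nat)
    also have "P m * (C m * ?D) powr t = (P m * C m powr t) * ?D powr t"
      using C_pos[of m] D by (simp add: powr_mult)
    also have "\<dots> \<le> e / (?D powr t + 1) * (?D powr t + 1)"
      using m(2) P_pos[of m] e by (intro mult_mono) (auto intro!: divide_nonneg_nonneg add_nonneg_nonneg)
    also have "\<dots> = e"
      using powr_ge_zero[of ?D t] by (simp del: powr_ge_zero)
    finally show ?thesis by (simp add: ennreal_leI)
  qed
  then have le: "hausdorff_premeasure t \<delta> F \<le> 0 + ennreal e" if "0 < \<delta>" "0 < e" for \<delta> e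
    using that by (simp only: add_0_left)
  have "hausdorff_premeasure t \<delta> F \<le> 0" if "0 < \<delta>" for \<delta>
    by (rule ennreal_le_epsilon) (rule le[OF that])
  then show ?thesis
    unfolding hausdorff_measure_def by (intro antisym SUP_least) simp_all
qed

end

section \<open>The gauge function\<close>

lemma h1_star_exp:
  assumes "0 < t"
  shows "h1_star s \<beta> \<gamma> t =
    exp (s * ln t - (1 - \<gamma>) * sqrt (2 * \<beta> * (- ln t) * ln (ln (\<beta> * (- ln t)))))"
  using assms by (simp add: h1_star_def powr_def ln_div exp_add[symmetric])

text \<open>In the variable \<open>x = \<beta> * ln (1 / t)\<close> the gauge is
  \<open>exp (- \<Phi> x)\<close>. The root has a derivative tending to 0, so the linear term
  \<open>s / \<beta> * x\<close> wins whatever the sign of \<open>1 - \<gamma>\<close>, and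
  \<open>\<Phi>\<close> increases for large \<open>x\<close>. The cutoff \<open>r0\<close>
  corresponds to \<open>x0\<close>.\<close>

lemma h1_admissible_exists:
  assumes s: "0 < s" and \<beta>: "0 < \<beta>"
  shows "\<exists>r0. h1_admissible s \<beta> \<gamma> r0"
proof -
  define g where "g x = sqrt (2 * x * ln (ln x))" for x :: real
  define g' where "g' x = (ln (ln x) + 1 / ln x) / sqrt (2 * x * ln (ln x))" for x :: real
  have deriv: "(g has_real_derivative g' x) (at x)" if "1 < x" "1 < ln x" for x
  proof -
    have pos: "0 < x * ln (ln x)" using that by simp
    show ?thesis
      unfolding g_def[abs_def] g'_def using that
      by (auto intro!: derivative_eq_intros simp: field_simps) (use pos in linarith)
  qed
  have "(g' \<longlongrightarrow> 0) at_top" unfolding g'_def[abs_def] by real_asymp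
  then have "((\<lambda>x. (1 - \<gamma>) * g' x) \<longlongrightarrow> 0) at_top" by (rule tendsto_mult_right_zero)
  then have "\<forall>\<^sub>F x in at_top. - (s / \<beta>) < (1 - \<gamma>) * g' x"
    using s \<beta> by (intro order_tendstoD(1)) auto
  moreover have "\<forall>\<^sub>F x::real in at_top. 1 < x \<and> 1 < ln x"
    by (intro eventually_conj) real_asymp+
  ultimately have "\<forall>\<^sub>F x in at_top. - (s / \<beta>) < (1 - \<gamma>) * g' x \<and> 1 < x \<and> 1 < ln x"
    by (rule eventually_conj)
  then obtain x0 where x0: "\<And>x. x0 \<le> x \<Longrightarrow> - (s / \<beta>) < (1 - \<gamma>) * g' x \<and> 1 < x \<and> 1 < ln x"
    by (auto simp: eventually_at_top_linorder)
  define \<Phi> where "\<Phi> x = s / \<beta> * x + (1 - \<gamma>) * g x" for x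
  have mono: "\<Phi> x \<le> \<Phi> y" if "x0 \<le> x" "x \<le> y" for x y
  proof (rule DERIV_nonneg_imp_nondecreasing[OF that(2)])
    fix z assume "x \<le> z" "z \<le> y"
    then have z: "- (s / \<beta>) < (1 - \<gamma>) * g' z" "1 < z" "1 < ln z" using x0[of z] that by auto
    have "(\<Phi> has_real_derivative (s / \<beta> + (1 - \<gamma>) * g' z)) (at z)"
      unfolding \<Phi>_def[abs_def] using deriv[OF z(2,3)] \<beta> by (auto intro!: derivative_eq_intros)
    then show "\<exists>d. (\<Phi> has_real_derivative d) (at z) \<and> 0 \<le> d" using z(1) by force
  qed
  define r0 where "r0 = exp (- (x0 / \<beta>))"
  have L: "x0 \<le> \<beta> * (- ln t)" if "t \<in> {0<..r0}" for t
  proof -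
    have "ln t \<le> - (x0 / \<beta>)" using that ln_le_cancel_iff[of t r0] by (simp add: r0_def)
    then show ?thesis using \<beta> by (simp add: field_simps)
  qed
  have h: "h1_star s \<beta> \<gamma> t = exp (- \<Phi> (\<beta> * (- ln t)))" if "0 < t" for t
    unfolding h1_star_exp[OF that] \<Phi>_def g_def using \<beta> by (simp add: mult.assoc)
  have "h1_admissible s \<beta> \<gamma> r0"
    unfolding h1_admissible_def
  proof (intro conjI ballI)
    show "0 < r0" by (simp add: r0_def)
    show "mono_on {0<..r0} (h1_star s \<beta> \<gamma>)"
    proof (rule mono_onI)
      fix t u assume tu: "t \<in> {0<..r0}" "u \<in> {0<..r0}" "t \<le> u"
      then have "\<beta> * (- ln u) \<le> \<beta> * (- ln t)" using \<beta> by (intro mult_left_mono) auto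
      then show "h1_star s \<beta> \<gamma> t \<le> h1_star s \<beta> \<gamma> u"
        using mono[OF L[OF tu(2)]] tu by (simp add: h)
    qed
    fix t assume t: "t \<in> {0<..r0}"
    then have ln: "1 < ln (\<beta> * (- ln t))" using x0[OF L] by blast
    have pos: "0 < \<beta> * (- ln t)" using x0[OF L[OF t]] by simp
    have gt1: "1 < \<beta> * (- ln t)" using x0[OF L[OF t]] by blast
    have nn: "0 \<le> 2 * (\<beta> * (- ln t)) * ln (ln (\<beta> * (- ln t)))"
    proof (rule mult_nonneg_nonneg)
      show "0 \<le> 2 * (\<beta> * (- ln t))" using pos by linarith
      show "0 \<le> ln (ln (\<beta> * (- ln t)))" using ln by (intro ln_ge_zero) linarith
    qed
    have "ln (1 / t) = - ln t" using t by (simp add: ln_div)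
    then show "h1_defined \<beta> t"
      using t ln pos gt1 nn unfolding h1_defined_def by (simp add: mult.assoc)
  qed
  then show ?thesis ..
qed

text \<open>Here \<open>\<tau>\<close> bounds \<open>ln (1 / t) / m\<close>. The condition
  \<open>\<beta> * \<tau> \<le> 1\<close> compares the iterated logarithms, and
  \<open>8 * (\<beta> * \<tau>) \<le> a\<^sup>2\<close> is 2 * \<beta> * \<tau> <= (a / 2)^2, which
  compares the roots. The root being nonnegative, \<open>1 - \<gamma> \<le> 1\<close> does the
  rest.\<close>

lemma h1_star_ge:
  assumes t: "0 < t" and \<beta>: "0 < \<beta>" and \<gamma>: "0 \<le> \<gamma>" and a: "0 \<le> a"
    and T: "- ln t \<le> \<tau> * m" "1 \<le> ln (\<beta> * (- ln t))" "0 < \<beta> * (- ln t)" and \<tau>: "\<beta> * \<tau> \<le> 1" "8 * (\<beta> * \<tau>) \<le> a\<^sup>2"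
    and m: "1 \<le> ln (ln m)" "0 < m"
  shows "exp (s * ln t - a / 2 * sqrt (m * ln (ln m))) \<le> h1_star s \<beta> \<gamma> t"
proof -
  let ?T = "\<beta> * (- ln t)"
  note Tpos = T(3)
  have Tm: "?T \<le> \<beta> * \<tau> * m" using mult_left_mono[OF T(1), of \<beta>] \<beta> by (simp add: mult.assoc)
  also have "\<dots> \<le> m" using mult_right_mono[OF \<tau>(1), of m] m by simp
  finally have "ln ?T \<le> ln m" by (rule ln_mono[OF _ Tpos])
  then have "ln (ln ?T) \<le> ln (ln m)" by (rule ln_mono) (use T(2) in linarith)
  then have "?T * ln (ln ?T) \<le> ?T * ln (ln m)" using Tpos by (intro mult_left_mono) auto
  also have "\<dots> \<le> (\<beta> * \<tau> * m) * ln (ln m)" using Tm m by (intro mult_right_mono) auto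
  finally have "8 * (?T * ln (ln ?T)) \<le> 8 * (\<beta> * \<tau>) * (m * ln (ln m))" by simp
  also have "\<dots> \<le> a\<^sup>2 * (m * ln (ln m))" using \<tau>(2) m by (intro mult_right_mono) auto
  finally have "2 * ?T * ln (ln ?T) \<le> (a / 2)\<^sup>2 * (m * ln (ln m))" by (simp add: power_divide)
  then have "sqrt (2 * ?T * ln (ln ?T)) \<le> a / 2 * sqrt (m * ln (ln m))"
    using a by (metis real_sqrt_abs real_sqrt_le_mono real_sqrt_mult abs_of_nonneg divide_nonneg_pos zero_less_numeral)
  moreover have "0 \<le> 2 * ?T * ln (ln ?T)"
  proof (rule mult_nonneg_nonneg)
    show "0 \<le> 2 * ?T" using Tpos by linarith
    show "0 \<le> ln (ln ?T)" using T(2) by (intro ln_ge_zero)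
  qed
  then have "0 \<le> sqrt (2 * ?T * ln (ln ?T))" by (rule real_sqrt_ge_zero)
  then have "(1 - \<gamma>) * sqrt (2 * ?T * ln (ln ?T)) \<le> 1 * sqrt (2 * ?T * ln (ln ?T))"
    using \<gamma> by (intro mult_right_mono) auto
  ultimately show ?thesis
    unfolding h1_star_exp[OF t] by (simp add: mult.assoc)
qed

section \<open>Equicontractive random systems\<close>

context rifs begin

lemma space_mu: "space \<mu> = \<Lambda>"
proof -
  have "space \<mu> = space (restrict_space borel \<Lambda>)" by (rule sets_eq_imp_space_eq[OF sets_mu])
  then show ?thesis by (simp add: space_restrict_space)
qed

lemma space_P_H: "w \<in> space (P_H \<mu>) \<Longrightarrow> w i \<in> \<Lambda>"
  by (auto simp: P_H_def space_PiM space_mu)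

lemma ratio_1_measurable: "(\<lambda>l. c l 1) \<in> borel_measurable \<mu>"
proof -
  have eq1: "{l \<in> \<Lambda>. 1 \<le> N l} = space \<mu>" using N_ge_1 by (auto simp: space_mu)
  have "sets (restrict_space \<mu> (space \<mu>)) = sets \<mu>"
    by (auto simp: sets_restrict_space image_iff)
  then have eq2: "measurable (restrict_space \<mu> (space \<mu>)) borel = borel_measurable \<mu>"
    by (rule measurable_cong_sets) simp
  show ?thesis using c_measurable[OF order_refl] unfolding eq1 eq2 .
qed

end

text \<open>The common ratio is read off at index 1, which belongs to every family because
  \<open>N l \<ge> 1\<close>.\<close>

locale equicontractive_rifs = rifs \<Lambda> \<mu> N f c \<Delta>
  for \<Lambda> :: "'k::euclidean_space set" and \<mu> :: "'k measure" and N :: "'k \<Rightarrow> nat"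
    and f :: "'k \<Rightarrow> nat \<Rightarrow> 'a::euclidean_space \<Rightarrow> 'a" and c :: "'k \<Rightarrow> nat \<Rightarrow> real"
    and \<Delta> :: "'a set" +
  fixes U :: "'a set" and cmin cmax :: real
  assumes U_nonempty: "U \<noteq> {}" and open_U: "open U"
    and U_invariant: "\<And>l i. l \<in> \<Lambda> \<Longrightarrow> i \<in> {1..N l} \<Longrightarrow> f l i ` U \<subseteq> U"
    and U_disjoint: "\<And>l i j. l \<in> \<Lambda> \<Longrightarrow> i \<in> {1..N l} \<Longrightarrow> j \<in> {1..N l} \<Longrightarrow> i \<noteq> j \<Longrightarrow>
      f l i ` U \<inter> f l j ` U = {}"
    and bdd_N: "bdd_above (N ` \<Lambda>)"
    and cmin: "0 < cmin" and cmax: "cmax < 1"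
    and equal_ratio: "\<And>l i. l \<in> \<Lambda> \<Longrightarrow> i \<in> {1..N l} \<Longrightarrow> c l i = c l 1"
    and ratio_1: "\<And>l. l \<in> \<Lambda> \<Longrightarrow> c l 1 \<in> {cmin..cmax}"
begin

text \<open>For \<open>l\<close> in \<open>\<Lambda>\<close> this is the logarithm of
  \<open>ratio_sum N c l t\<close>. Being affine in \<open>t\<close>, its mean has the explicit zero
  \<open>EN / EC\<close>.\<close>

definition X :: "real \<Rightarrow> 'k \<Rightarrow> real" where "X t l = ln (real (N l)) + t * ln (c l 1)"

lemma X_measurable[measurable]: "X t \<in> borel_measurable \<mu>"
proof -
  have [measurable]: "(\<lambda>l. c l 1) \<in> borel_measurable \<mu>" by (rule ratio_1_measurable)
  have [measurable]: "(\<lambda>l. real (N l)) \<in> borel_measurable \<mu>"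
    by (rule measurable_compose[OF N_measurable]) simp
  show ?thesis unfolding X_def[abs_def] by measurable
qed

lemma ln_ratio_bounds:
  assumes "l \<in> \<Lambda>" shows "ln cmin \<le> ln (c l 1)" "ln (c l 1) \<le> ln cmax" "ln cmax < 0"
proof -
  have "cmin \<le> c l 1" "c l 1 \<le> cmax" using ratio_1[OF assms] by auto
  then show "ln cmin \<le> ln (c l 1)" "ln (c l 1) \<le> ln cmax" "ln cmax < 0"
    using cmin cmax by auto
qed

lemma ln_ratio_sum:
  assumes "l \<in> \<Lambda>" shows "ratio_sum N c l t = exp (X t l)"
proof -
  have "ratio_sum N c l t = (\<Sum>j = 1..N l. c l 1 powr t)"
    unfolding ratio_sum_def
    by (intro sum.cong refl arg_cong2[where f = "(powr)"] equal_ratio[OF assms])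
  also have "\<dots> = real (N l) * c l 1 powr t" by simp
  also have "\<dots> = exp (X t l)"
    using N_ge_1[OF assms] ratio_1[OF assms] cmin by (simp add: X_def exp_add powr_def)
  finally show ?thesis .
qed

lemma X_bounded: "\<exists>B. \<forall>l\<in>\<Lambda>. \<bar>X t l\<bar> \<le> B"
proof -
  obtain n where n: "\<And>l. l \<in> \<Lambda> \<Longrightarrow> N l \<le> n" using bdd_N by (auto simp: bdd_above_def)
  have "\<bar>X t l\<bar> \<le> ln (real n) + \<bar>t\<bar> * (- ln cmin)" if l: "l \<in> \<Lambda>" for l
  proof -
    have "0 \<le> ln (real (N l))" "ln (real (N l)) \<le> ln (real n)"
      using N_ge_1[OF l] n[OF l] by auto
    moreover have "\<bar>t * ln (c l 1)\<bar> \<le> \<bar>t\<bar> * (- ln cmin)"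
      unfolding abs_mult using ln_ratio_bounds[OF l] by (intro mult_left_mono) auto
    ultimately show ?thesis unfolding X_def by linarith
  qed
  then show ?thesis by blast
qed

lemma X_integrable: "integrable \<mu> (X t)"
proof -
  obtain B where "\<And>l. l \<in> \<Lambda> \<Longrightarrow> \<bar>X t l\<bar> \<le> B" using X_bounded by blast
  then show ?thesis
    by (intro integrable_const_bound[where B = B]) (auto simp: space_mu intro!: AE_I2)
qed

section \<open>Drift of the sums and identification of \<open>s\<close>\<close>

definition EN :: real where "EN = expectation (\<lambda>l. ln (real (N l)))"

definition EC :: real where "EC = expectation (\<lambda>l. - ln (c l 1))"

lemma expectation_X: "expectation (X t) = EN - t * EC"
proof -
  have "integrable \<mu> (\<lambda>l. X 0 l)" "integrable \<mu> (\<lambda>l. X 0 l - X 1 l)"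
    by (intro X_integrable Bochner_Integration.integrable_diff)+
  then have "integrable \<mu> (\<lambda>l. ln (real (N l)))" "integrable \<mu> (\<lambda>l. - ln (c l 1))"
    by (simp_all add: X_def)
  then have "expectation (\<lambda>l. ln (real (N l)) - t * (- ln (c l 1))) = EN - t * EC"
    unfolding EN_def EC_def by (subst Bochner_Integration.integral_diff) auto
  then show ?thesis by (simp add: X_def[abs_def])
qed

lemma EC_pos: "0 < EC"
proof -
  have "integrable \<mu> (\<lambda>l. X 0 l - X 1 l)"
    by (intro X_integrable Bochner_Integration.integrable_diff)
  then have int: "integrable \<mu> (\<lambda>l. - ln (c l 1))" by (simp add: X_def)
  obtain l where l: "l \<in> \<Lambda>" using param_nonempty by blast
  have "- ln cmax \<le> EC"
  proof -
    have "expectation (\<lambda>l. - ln cmax) \<le> EC"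
      unfolding EC_def using int ln_ratio_bounds by (intro integral_mono) (auto simp: space_mu)
    then show ?thesis by (simp add: prob_space)
  qed
  then show ?thesis using ln_ratio_bounds(3)[OF l] by linarith
qed

lemma homogeneous_ifs_realisation:
  assumes "w \<in> space (P_H \<mu>)"
  shows "homogeneous_ifs N f \<Delta> U w (\<lambda>i. c (w i) 1) cmax"
proof
  fix i
  have wi: "w i \<in> \<Lambda>" using space_P_H[OF assms] .
  show "1 \<le> N (w i)" by (rule N_ge_1[OF wi])
  show "0 < c (w i) 1" "c (w i) 1 \<le> cmax" using ratio_1[OF wi] cmin by auto
  show "norm (f (w i) j x - f (w i) j y) = c (w i) 1 * norm (x - y)" if "j \<in> {1..N (w i)}" for j x y
    using similarity[OF wi that] equal_ratio[OF wi that] by simp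
  show "f (w i) j ` \<Delta> \<subseteq> \<Delta>" "f (w i) j ` U \<subseteq> U" if "j \<in> {1..N (w i)}" for j
    using that Delta_invariant[OF wi] U_invariant[OF wi] by auto
  show "f (w i) j ` U \<inter> f (w i) j' ` U = {}"
    if "j \<in> {1..N (w i)}" "j' \<in> {1..N (w i)}" "j \<noteq> j'" for j j'
    using U_disjoint[OF wi that] .
qed (use cmax compact_Delta Delta_nonempty U_nonempty open_U in auto)

lemma P_C_exp:
  assumes "w \<in> space (P_H \<mu>)"
  shows "homogeneous_ifs.P N w m * homogeneous_ifs.C (\<lambda>i. c (w i) 1) m powr t = exp (\<Sum>i<m. X t (w i))"
proof -
  interpret H: homogeneous_ifs N f \<Delta> U w "\<lambda>i. c (w i) 1" cmax
    by (rule homogeneous_ifs_realisation[OF assms])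
  have "H.C m powr t = (\<Prod>i<m. c (w i) 1 powr t)"
    unfolding H.C_def using H.r_pos by (subst prod_powr_distrib) (auto intro: less_imp_le)
  then have "H.P m * H.C m powr t = (\<Prod>i<m. real (N (w i)) * c (w i) 1 powr t)"
    by (simp add: H.P_def prod.distrib)
  also have "\<dots> = (\<Prod>i<m. exp (X t (w i)))"
  proof (rule prod.cong)
    fix i
    show "real (N (w i)) * c (w i) 1 powr t = exp (X t (w i))"
      using H.N_pos[of i] H.r_pos[of i] by (simp add: X_def exp_add powr_def)
  qed simp
  also have "\<dots> = exp (\<Sum>i<m. X t (w i))" by (simp add: exp_sum)
  finally show ?thesis .
qed

text \<open>The sums of \<open>X t\<close> have negative drift, so \<open>P m * C m powr t\<close>
  is arbitrarily small for suitable large \<open>m\<close>.\<close>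

lemma hausdorff_dim_le:
  assumes t: "0 < t" "EN < t * EC"
  shows "AE w in P_H \<mu>. hausdorff_dim (homogeneous_attractor N f \<Delta> w) \<le> t"
proof -
  obtain B where B: "\<And>l. l \<in> \<Lambda> \<Longrightarrow> \<bar>X t l\<bar> \<le> B" using X_bounded by blast
  have "AE w in P_H \<mu>. \<forall>K n0. \<exists>m\<ge>n0. K \<le> (\<Sum>i<m. - X t (w i))"
    using t B by (intro P_H_sums_unbounded[where B = B]) (auto simp: space_mu expectation_X)
  with AE_space show ?thesis
  proof eventually_elim
    case (elim w)
    interpret H: homogeneous_ifs N f \<Delta> U w "\<lambda>i. c (w i) 1" cmax
      by (rule homogeneous_ifs_realisation[OF elim(1)])
    have "hausdorff_measure t H.F = 0"
    proof (rule H.hausdorff_measure_attractor_eq_0[OF t(1)])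
      fix e :: real and n0 assume e: "0 < e"
      obtain m where m: "m \<ge> n0" "- ln e \<le> (\<Sum>i<m. - X t (w i))" using elim(2) by blast
      then have "exp (\<Sum>i<m. X t (w i)) \<le> exp (ln e)" by (simp add: sum_negf)
      then show "\<exists>m\<ge>n0. H.P m * H.C m powr t \<le> e"
        using m(1) e P_C_exp[OF elim(1)] by (intro exI[of _ m]) simp
    qed
    then show ?case
      unfolding hausdorff_dim_def using t(1)
      by (intro cInf_lower bdd_belowI[of _ 0]) auto
  qed
qed

text \<open>The sums of \<open>X t\<close> have positive drift, so \<open>P m * C m powr t\<close>
  is unbounded.\<close>

lemma packing_dim_ge:
  assumes t: "0 < t" "t * EC < EN"
  shows "AE w in P_H \<mu>. t \<le> packing_dim (homogeneous_attractor N f \<Delta> w)"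
proof -
  obtain B where B: "\<And>l. l \<in> \<Lambda> \<Longrightarrow> \<bar>X t l\<bar> \<le> B" using X_bounded by blast
  have "AE w in P_H \<mu>. \<forall>K n0. \<exists>m\<ge>n0. K \<le> (\<Sum>i<m. X t (w i))"
    using t B by (intro P_H_sums_unbounded[where B = B]) (auto simp: space_mu expectation_X)
  with AE_space show ?thesis
  proof eventually_elim
    case (elim w)
    interpret H: homogeneous_ifs N f \<Delta> U w "\<lambda>i. c (w i) 1" cmax
      by (rule homogeneous_ifs_realisation[OF elim(1)])
    \<comment> \<open>All exponents up to \<open>t\<close> are needed to bound the infimum; they
      follow from \<open>t\<close> because \<open>C m \<le> 1\<close>.\<close>
    have inf: "packing_measure (\<lambda>u. u powr t') H.F = \<infinity>" if "t' \<le> t" for t'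
    proof (rule H.packing_measure_attractor_eq_top)
      fix K :: real and n0
      obtain m where m: "m \<ge> n0" "K \<le> (\<Sum>i<m. X t (w i))" using elim(2) by blast
      have "K \<le> exp (\<Sum>i<m. X t (w i))"
        using m(2) exp_ge_add_one_self[of "\<Sum>i<m. X t (w i)"] by linarith
      also have "\<dots> = H.P m * H.C m powr t" by (rule P_C_exp[OF elim(1), symmetric])
      also have "\<dots> \<le> H.P m * H.C m powr t'"
        using H.C_pos[of m] H.C_le_1[of m] H.P_pos[of m] that
        by (intro mult_left_mono powr_mono') auto
      finally show "\<exists>m\<ge>n0. K \<le> H.P m * H.C m powr t'" using m(1) by blast
    qed
    have "real (Suc DIM('a)) \<in> {t. 0 < t \<and> packing_measure (\<lambda>u. u powr t) H.F = 0}"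
      using packing_measure_powr_Suc_DIM_eq_0[OF H.bounded_attractor] by simp
    moreover have "t \<le> t'" if "t' \<in> {t. 0 < t \<and> packing_measure (\<lambda>u. u powr t) H.F = 0}" for t'
      using that inf[of t'] by (cases "t' \<le> t") auto
    ultimately show ?case unfolding packing_dim_def by (intro cInf_greatest) blast+
  qed
qed

text \<open>The Hausdorff bound gives \<open>s \<le> t\<close> for every \<open>t\<close> above
  \<open>s0\<close>, and the packing bound gives \<open>t \<le> s\<close> for every positive
  \<open>t\<close> below \<open>s0\<close>. Almost sure statements about constants are plain ones in
  a probability space.\<close>

lemma dimension_eq:
  assumes "0 < EN"
    and dim: "AE w in P_H \<mu>. hausdorff_dim (homogeneous_attractor N f \<Delta> w) = s \<and>
                         packing_dim (homogeneous_attractor N f \<Delta> w) = s"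
  shows "0 < s" "expectation (X s) = 0"
proof -
  interpret P: prob_space "P_H \<mu>" by (rule prob_space_P_H)
  define s0 where "s0 = EN / EC"
  have s0: "0 < s0" "s0 * EC = EN" using assms(1) EC_pos by (auto simp: s0_def)
  have le: "s \<le> t" if "s0 < t" for t
  proof -
    have "s0 * EC < t * EC" using that EC_pos by (intro mult_strict_right_mono) auto
    then have "AE w in P_H \<mu>. hausdorff_dim (homogeneous_attractor N f \<Delta> w) \<le> t"
      using s0 that by (intro hausdorff_dim_le) auto
    with dim have "AE w in P_H \<mu>. s \<le> t" by eventually_elim simp
    then show ?thesis by simp
  qed
  have ge: "t \<le> s" if "0 < t" "t < s0" for t
  proof -
    have "t * EC < s0 * EC" using that EC_pos by (intro mult_strict_right_mono) auto
    then have "AE w in P_H \<mu>. t \<le> packing_dim (homogeneous_attractor N f \<Delta> w)"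
      using s0 that by (intro packing_dim_ge) auto
    with dim have "AE w in P_H \<mu>. t \<le> s" by eventually_elim simp
    then show ?thesis by simp
  qed
  have "s \<le> s0" using le by (rule dense_ge)
  moreover have "s0 \<le> s"
  proof (rule dense_le_bounded[OF s0(1)])
    fix t assume "0 < t" "t < s0" then show "t \<le> s" by (rule ge)
  qed
  ultimately have "s = s0" by simp
  then show "0 < s" "expectation (X s) = 0" using s0 by (auto simp: expectation_X)
qed

theorem packing_measure_attractor_infinite:
  fixes s \<epsilon> :: real
  assumes EN: "0 < EN" and ad: "\<not> almost_deterministic \<mu> N c"
    and dim: "AE w in P_H \<mu>. hausdorff_dim (homogeneous_attractor N f \<Delta> w) = s \<and>
                         packing_dim (homogeneous_attractor N f \<Delta> w) = s"
    and \<epsilon>: "0 < \<epsilon>"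
  defines "V \<equiv> prob_space.variance (P_H \<mu>) (\<lambda>w. ln (ratio_sum N c (w 0) s))"
  shows "\<exists>\<eta>>0. (\<exists>r0. h1_admissible s (\<eta> * V) \<epsilon> r0) \<and>
       (\<forall>r0. h1_admissible s (\<eta> * V) \<epsilon> r0 \<longrightarrow>
          (AE w in P_H \<mu>.
             packing_measure (gauge_extension r0 (h1_star s (\<eta> * V) \<epsilon>))
               (homogeneous_attractor N f \<Delta> w) = \<infinity>))"
proof -
  have s: "0 < s" "expectation (X s) = 0" by (rule dimension_eq[OF EN dim])+
  obtain B where B: "\<And>l. l \<in> \<Lambda> \<Longrightarrow> \<bar>X s l\<bar> \<le> B" using X_bounded by blast
  interpret iid: iid_centered "P_H \<mu>" "\<lambda>i w. X s (w i)"
    using B s by (intro iid_centered_P_H[where B = B]) (auto simp: space_mu)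
  \<comment> \<open>The variance is the second moment, since the mean at \<open>s\<close> is
    zero.\<close>
  have V: "V = iid.v"
  proof -
    have eq: "ln (ratio_sum N c (w 0) s) = X s (w 0)" if "w \<in> space (P_H \<mu>)" for w
      by (simp add: ln_ratio_sum[OF space_P_H[OF that]])
    have "iid.expectation (\<lambda>w. ln (ratio_sum N c (w 0) s)) = 0"
      using Bochner_Integration.integral_cong[OF refl eq] iid.mean_0 by metis
    then show ?thesis
      unfolding V_def iid.v_def by (auto intro!: Bochner_Integration.integral_cong simp: eq)
  qed
  have v_pos: "0 < iid.v"
  proof -
    \<comment> \<open>Zero variance would make \<open>X s\<close> vanish almost everywhere, so that
      the ratio sum at \<open>s\<close> is almost surely 1 and the system almost
      deterministic.\<close>
    have "iid.v \<noteq> 0"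
    proof
      assume "iid.v = 0"
      moreover have "iid.v = expectation (\<lambda>l. (X s l)\<^sup>2)"
        unfolding iid.v_def by (rule expectation_P_H) simp
      moreover have "integrable \<mu> (\<lambda>l. (X s l)\<^sup>2)"
      proof (rule integrable_const_bound[where B = "B\<^sup>2"])
        show "AE l in \<mu>. norm ((X s l)\<^sup>2) \<le> B\<^sup>2"
        proof (rule AE_I2)
          fix l assume "l \<in> space \<mu>"
          then show "norm ((X s l)\<^sup>2) \<le> B\<^sup>2"
            using power_mono[OF B[of l], of 2] by (simp add: space_mu)
        qed
      qed simp
      ultimately have "AE l in \<mu>. (X s l)\<^sup>2 = 0"
        by (subst integral_nonneg_eq_0_iff_AE[symmetric]) auto
      with AE_space have "AE l in \<mu>. ratio_sum N c l s = 1"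
        by eventually_elim (simp add: ln_ratio_sum space_mu)
      with ad show False by (auto simp: almost_deterministic_def)
    qed
    moreover have "0 \<le> iid.v" unfolding iid.v_def by simp
    ultimately show ?thesis by simp
  qed
  obtain a where a: "a > 0"
    "AE w in P_H \<mu>. \<exists>\<^sub>F n in sequentially. a * sqrt (n * ln (ln n)) \<le> iid.S {..<n} w"
    using iid.lil_lower_bound[OF v_pos] by blast

  obtain l0 where "l0 \<in> \<Lambda>" using param_nonempty by blast
  note bnd0 = ln_ratio_bounds[OF this]
  define \<tau> where "\<tau> = - ln cmin"
  have \<tau>: "\<tau> > 0" using bnd0 by (simp add: \<tau>_def)
  \<comment> \<open>Solves \<open>\<beta> * \<tau> = min 1 (a\<^sup>2 / 8)\<close>, which is both
    conditions of \<open>h1_star_ge\<close> at once. Since \<open>a\<close> is the same for almost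
    all \<open>w\<close>, so is \<open>\<eta>\<close>.\<close>
  define \<eta> where "\<eta> = min 1 (a\<^sup>2 / 8) / (iid.v * \<tau>)"
  define \<beta> where "\<beta> = \<eta> * V"
  have \<eta>: "\<eta> > 0" using a v_pos \<tau> by (auto simp: \<eta>_def)
  have \<beta>: "\<beta> > 0" using \<eta> v_pos by (simp add: \<beta>_def V)
  have \<beta>\<tau>: "\<beta> * \<tau> \<le> 1" "8 * (\<beta> * \<tau>) \<le> a\<^sup>2"
    using v_pos \<tau> by (simp_all add: \<beta>_def V \<eta>_def)

  have "AE w in P_H \<mu>. packing_measure (gauge_extension r0 (h1_star s \<beta> \<epsilon>))
      (homogeneous_attractor N f \<Delta> w) = \<infinity>" if adm: "h1_admissible s \<beta> \<epsilon> r0" for r0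
    using AE_space a(2)
  proof eventually_elim
    case (elim w)
    interpret H: homogeneous_ifs N f \<Delta> U w "\<lambda>i. c (w i) 1" cmax
      by (rule homogeneous_ifs_realisation[OF elim(1)])
    have r0: "0 < r0" using adm by (simp add: h1_admissible_def)
    have T: "- ln cmax * m \<le> - ln (H.C m)" "- ln (H.C m) \<le> \<tau> * m" for m
    proof -
      have "ln (H.C m) = (\<Sum>i<m. ln (c (w i) 1))"
        unfolding H.C_def
        by (intro ln_prod finite_lessThan not_sym[OF less_imp_neq] H.r_pos)
      moreover have "(\<Sum>i<m. ln cmin) \<le> (\<Sum>i<m. ln (c (w i) 1))" "(\<Sum>i<m. ln (c (w i) 1)) \<le> (\<Sum>i<m. ln cmax)"
        by (rule sum_mono, rule ln_ratio_bounds[OF space_P_H[OF elim(1)]])+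
      ultimately show "- ln cmax * m \<le> - ln (H.C m)" "- ln (H.C m) \<le> \<tau> * m"
        by (auto simp: \<tau>_def mult.commute)
    qed
    show ?case
    proof (rule H.packing_measure_attractor_eq_top)
      fix K :: real and n0 :: nat
      \<comment> \<open>Conditions on large \<open>m\<close>: \<open>\<beta> * ln (1 / C m)\<close>
        is at least e, so its logarithm is at least 1; \<open>C m < r0\<close>, so the extended
        gauge agrees with the formula; and half of the fluctuation already exceeds
        \<open>K\<close>.\<close>
      have "filterlim (\<lambda>m. - ln cmax * real m) at_top sequentially"
        using bnd0(3) by (intro filterlim_tendsto_pos_mult_at_top[OF tendsto_const] filterlim_real_sequentially) auto
      then have "\<forall>\<^sub>F m in sequentially. exp 1 / \<beta> \<le> - ln cmax * real m" by (simp add: filterlim_at_top)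
      moreover have "\<forall>\<^sub>F m in sequentially. H.C m < r0" using H.C_tendsto r0 by (rule order_tendstoD)
      moreover have "\<forall>\<^sub>F m::nat in sequentially. 1 \<le> ln (ln (real m)) \<and> K \<le> a / 2 * sqrt (real m * ln (ln (real m)))"
      proof (rule eventually_conj)
        show "\<forall>\<^sub>F m::nat in sequentially. 1 \<le> ln (ln (real m))" by real_asymp
        have "filterlim (\<lambda>m::nat. a / 2 * sqrt (real m * ln (ln (real m)))) at_top sequentially"
          using a(1) by real_asymp
        then show "\<forall>\<^sub>F m::nat in sequentially. K \<le> a / 2 * sqrt (real m * ln (ln (real m)))"
          by (simp add: filterlim_at_top)
      qed
      ultimately have "\<forall>\<^sub>F m in sequentially. exp 1 / \<beta> \<le> - ln cmax * real m \<and> H.C m < r0 \<and>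
          (1 \<le> ln (ln (real m)) \<and> K \<le> a / 2 * sqrt (real m * ln (ln (real m)))) \<and> max 1 n0 \<le> m"
        using eventually_ge_at_top[of "max 1 n0"] by eventually_elim (intro conjI; simp only: conjunct1 conjunct2)
      from frequently_eventually_frequently[OF elim(2) this]
      obtain m where m: "a * sqrt (m * ln (ln m)) \<le> iid.S {..<m} w"
        "exp 1 / \<beta> \<le> - ln cmax * real m" "H.C m < r0" "1 \<le> ln (ln (real m))"
        "K \<le> a / 2 * sqrt (real m * ln (ln (real m)))" "max 1 n0 \<le> m"
        by (auto dest!: frequently_ex)
      let ?z = "sqrt (m * ln (ln m))"
      have "exp 1 / \<beta> \<le> - ln (H.C m)" using m(2) T(1)[of m] by linarith
      then have T1: "exp 1 \<le> \<beta> * (- ln (H.C m))" using \<beta> by (simp add: pos_divide_le_eq mult.commute)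
      then have T2: "0 < \<beta> * (- ln (H.C m))" using exp_gt_zero[of "1::real"] by linarith
      then have "1 \<le> ln (\<beta> * (- ln (H.C m)))" using T1 by (subst ln_ge_iff) auto
      then have ge: "exp (s * ln (H.C m) - a / 2 * ?z) \<le> h1_star s \<beta> \<epsilon> (H.C m)"
        using \<beta> \<beta>\<tau> \<epsilon> a(1) T(2)[of m] T2 m(4,6) H.C_pos[of m]
        by (intro h1_star_ge[where \<tau> = \<tau>]) auto
      have "exp (iid.S {..<m} w) = H.P m * exp (s * ln (H.C m))"
        using P_C_exp[OF elim(1), of m s] H.C_pos[of m] by (simp add: iid.S_def powr_def)
      then have eq: "exp (iid.S {..<m} w - a / 2 * ?z) = H.P m * exp (s * ln (H.C m) - a / 2 * ?z)"
        by (simp only: exp_diff times_divide_eq_right)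
      \<comment> \<open>The sum is at least \<open>a * ?z\<close> and the gauge costs at most half
        of that; the other half dominates \<open>K\<close>.\<close>
      have "K \<le> iid.S {..<m} w - a / 2 * ?z" using m(1,5) by simp
      also have "\<dots> \<le> exp (iid.S {..<m} w - a / 2 * ?z)"
        using exp_ge_add_one_self[of "iid.S {..<m} w - a / 2 * ?z"] by linarith
      also note eq
      also have "H.P m * exp (s * ln (H.C m) - a / 2 * ?z) \<le> H.P m * h1_star s \<beta> \<epsilon> (H.C m)"
        by (rule mult_left_mono[OF ge less_imp_le[OF H.P_pos]])
      finally have "K \<le> H.P m * h1_star s \<beta> \<epsilon> (H.C m)" .
      moreover have "gauge_extension r0 (h1_star s \<beta> \<epsilon>) (H.C m) = h1_star s \<beta> \<epsilon> (H.C m)"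
        using m(3) H.C_pos[of m] unfolding gauge_extension_def by simp
      ultimately show "\<exists>m\<ge>n0. K \<le> H.P m * gauge_extension r0 (h1_star s \<beta> \<epsilon>) (H.C m)"
        using m(6) by (intro exI[of _ m]) simp
    qed
  qed
  moreover have "\<exists>r0. h1_admissible s \<beta> \<epsilon> r0" by (rule h1_admissible_exists[OF s(1) \<beta>])
  ultimately show ?thesis using \<eta> unfolding \<beta>_def by blast
qed

end

text \<open>The cutoff \<open>r0\<close> of the gauge is a convention, so the conclusion is claimed
  for every admissible one; the existence clause keeps this from being vacuous.\<close>

theorem theorem5p3:
  fixes \<Lambda> :: "'k::euclidean_space set" and \<mu> :: "'k measure" and N :: "'k \<Rightarrow> nat"
    and f :: "'k \<Rightarrow> nat \<Rightarrow> 'a::euclidean_space \<Rightarrow> 'a" and c :: "'k \<Rightarrow> nat \<Rightarrow> real"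
    and \<Delta> :: "'a set" and cmin cmax s \<epsilon> :: real
  assumes "rifs \<Lambda> \<mu> N f c \<Delta>"
    and "uniform_osc \<Lambda> N f"
    and "bdd_above (N ` \<Lambda>)" and "2 \<le> (SUP l\<in>\<Lambda>. N l)"
    and "0 < prob_space.expectation (P_H \<mu>) (\<lambda>w. ln (real (N (w 0))))"
    and "0 < cmin" and "cmin \<le> cmax" and "cmax < 1"
    and "\<forall>l\<in>\<Lambda>. \<exists>cl\<in>{cmin..cmax}. \<forall>i\<in>{1..N l}. c l i = cl"
    and "\<not> almost_deterministic \<mu> N c"
    and "AE w in P_H \<mu>. hausdorff_dim (homogeneous_attractor N f \<Delta> w) = s \<and>
                         packing_dim (homogeneous_attractor N f \<Delta> w) = s"
    and "0 < \<epsilon>"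
  shows "\<exists>\<eta>::real. 0 < \<eta> \<and>
    (let \<beta> = \<eta> * prob_space.variance (P_H \<mu>) (\<lambda>w. ln (ratio_sum N c (w 0) s)) in
       (\<exists>r0. h1_admissible s \<beta> \<epsilon> r0) \<and>
       (\<forall>r0. h1_admissible s \<beta> \<epsilon> r0 \<longrightarrow>
          (AE w in P_H \<mu>.
             packing_measure (gauge_extension r0 (h1_star s \<beta> \<epsilon>))
               (homogeneous_attractor N f \<Delta> w) = \<infinity>)))"
proof -
  interpret rifs \<Lambda> \<mu> N f c \<Delta> by (rule assms(1))
  from assms(2)[unfolded uniform_osc_def] obtain U where U: "U \<noteq> {}" "open U"
    and inv: "\<forall>l\<in>\<Lambda>. (\<forall>i\<in>{1..N l}. f l i ` U \<subseteq> U) \<and>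
      (\<forall>i\<in>{1..N l}. \<forall>j\<in>{1..N l}. i \<noteq> j \<longrightarrow> f l i ` U \<inter> f l j ` U = {})"
    by (elim exE conjE)
  have U_inv: "f l i ` U \<subseteq> U" if "l \<in> \<Lambda>" "i \<in> {1..N l}" for l i
    by (rule bspec[OF conjunct1[OF bspec[OF inv that(1)]] that(2)])
  have U_disj: "f l i ` U \<inter> f l j ` U = {}"
    if "l \<in> \<Lambda>" "i \<in> {1..N l}" "j \<in> {1..N l}" "i \<noteq> j" for l i j
    by (rule mp[OF bspec[OF bspec[OF conjunct2[OF bspec[OF inv that(1)]] that(2)] that(3)] that(4)])
  have ratio_1: "c l i = c l 1" "c l 1 \<in> {cmin..cmax}" if l: "l \<in> \<Lambda>" and i: "i \<in> {1..N l}" for l i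
  proof -
    obtain cl where "cl \<in> {cmin..cmax}" and eq: "\<forall>i\<in>{1..N l}. c l i = cl"
      using bspec[OF assms(9) l] by (elim bexE)
    moreover have "1 \<in> {1..N l}" using N_ge_1[OF l] by simp
    ultimately show "c l i = c l 1" "c l 1 \<in> {cmin..cmax}"
      using bspec[OF eq i] bspec[OF eq, of 1] by simp_all
  qed
  interpret equicontractive_rifs \<Lambda> \<mu> N f c \<Delta> U cmin cmax
  proof
    show "c l 1 \<in> {cmin..cmax}" if "l \<in> \<Lambda>" for l
      using ratio_1(2)[OF that, of 1] N_ge_1[OF that] by simp
  qed (fact U U_inv U_disj ratio_1(1) assms)+
  have meas: "(\<lambda>l. ln (real (N l))) \<in> borel_measurable \<mu>"
    by (rule measurable_compose[OF N_measurable]) simp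
  \<comment> \<open>\<open>EN\<close> is a mean under \<open>\<mu>\<close>, whereas the hypothesis
    speaks of the first coordinate under \<open>P_H \<mu>\<close>.\<close>
  have "0 < EN" unfolding EN_def using expectation_P_H[OF meas, of 0] assms(5) by simp
  from packing_measure_attractor_infinite[OF this assms(10,11,12)] show ?thesis unfolding Let_def .
qed

end
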